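(* Let $n\ge1$ and let $\Bbbk$ be a field. The Cartan matrix of $\Bbbk\,\mathcal{PO}_n$ and $\Bbbk\,\mathcal{EO}_n$ (with respect to the ordering $[0],[1],\dots,[n]$, the index $i$ corresponding to $[i-1]$) is an $(n+1)\times(n+1)$ upper unitriangular matrix whose $(i,j)$ entry is $\binom{j-2}{i-2}$ for $j\ge i$.
   Context: $[k]=\{1,\dots,k\}$, $[0]=\varnothing$. $\mathcal{PO}_n$ is the monoid of all order-preserving partial functions on $[n]$ ($x\le y\Rightarrow f(x)\le f(y)$ for $x,y$ in the domain of $f$), and $\Bbbk\mathcal{PO}_n$ its monoid algebra. $\mathcal{EO}_n$ is the category whose objects are all subsets of $[n]$ and whose morphisms $A\to B$ are the order-preserving onto functions with domain $A$ and range $B$. The category algebra $\Bbbk\mathcal{EO}_n$ has basis the morphisms, with product $m'\cdot m=m'm$ if the composition is defined and $0$ otherwise. It is known that $\Bbbk\mathcal{PO}_n\simeq\Bbbk\mathcal{EO}_n$ as algebras. Two objects of $\mathcal{EO}_n$ are isomorphic if and only if they have the same cardinality, so $[0],\dots,[n]$ represent the isomorphism classes of objects. The Cartan matrix of a finite-dimensional algebra $A$ is the matrix with $(i,j)$ entry $\dim_\Bbbk e_iAe_j$, where $e_1,e_2,\dots$ are primitive idempotents representing the isomorphism classes of indecomposable projective modules (equivalently, the Cartan matrix is computed in a Morita equivalent basic algebra); here $e_i$ corresponds to the identity morphism of $[i-1]$. Binomial convention: $\binom{-1}{-1}=1$ and $\binom{m}{-1}=0$ for $m\ge0$. *)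

theory Defs
  imports "HOL-Algebra.QuotRing" "Jordan_Normal_Form.VS_Connect"
begin

hide_const (open) Multiset.mult

section \<open>Left modules over a ring\<close>

text \<open>The library's \<open>module\<close> locale requires a commutative ring of scalars. As usual for
  records of type \<open>module\<close>, the fields \<open>mult\<close> and \<open>one\<close> play no role
  when the record is read as a module. Submodules are \<open>Module.submodule\<close> of HOL-Algebra
  (which does not need commutativity), not the locale of the same name in VectorSpace.\<close>

locale left_module = R?: ring R + M?: abelian_group M
    for R :: "('a, 'r) ring_scheme" (structure) and M :: "('a, 'b, 'm) module_scheme" (structure) +
  assumes smult_closed:
      "\<lbrakk>a \<in> carrier R; x \<in> carrier M\<rbrakk> \<Longrightarrow> a \<odot>\<^bsub>M\<^esub> x \<in> carrier M"
    and smult_l_distr: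
      "\<lbrakk>a \<in> carrier R; b \<in> carrier R; x \<in> carrier M\<rbrakk> \<Longrightarrow>
        (a \<oplus>\<^bsub>R\<^esub> b) \<odot>\<^bsub>M\<^esub> x = a \<odot>\<^bsub>M\<^esub> x \<oplus>\<^bsub>M\<^esub> b \<odot>\<^bsub>M\<^esub> x"
    and smult_r_distr:
      "\<lbrakk>a \<in> carrier R; x \<in> carrier M; y \<in> carrier M\<rbrakk> \<Longrightarrow>
        a \<odot>\<^bsub>M\<^esub> (x \<oplus>\<^bsub>M\<^esub> y) = a \<odot>\<^bsub>M\<^esub> x \<oplus>\<^bsub>M\<^esub> a \<odot>\<^bsub>M\<^esub> y"
    and smult_assoc1:
      "\<lbrakk>a \<in> carrier R; b \<in> carrier R; x \<in> carrier M\<rbrakk> \<Longrightarrow>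
        (a \<otimes>\<^bsub>R\<^esub> b) \<odot>\<^bsub>M\<^esub> x = a \<odot>\<^bsub>M\<^esub> (b \<odot>\<^bsub>M\<^esub> x)"
    and smult_one: "x \<in> carrier M \<Longrightarrow> \<one>\<^bsub>R\<^esub> \<odot>\<^bsub>M\<^esub> x = x"

definition left_module_hom ::
  "('a, 'r) ring_scheme \<Rightarrow> ('a, 'b, 'm) module_scheme \<Rightarrow> ('a, 'c, 'n) module_scheme \<Rightarrow> ('b \<Rightarrow> 'c) set"
  where "left_module_hom R M N =
    {f \<in> carrier M \<rightarrow> carrier N.
      (\<forall>x\<in>carrier M. \<forall>y\<in>carrier M. f (x \<oplus>\<^bsub>M\<^esub> y) = f x \<oplus>\<^bsub>N\<^esub> f y) \<and>
      (\<forall>a\<in>carrier R. \<forall>x\<in>carrier M. f (a \<odot>\<^bsub>M\<^esub> x) = a \<odot>\<^bsub>N\<^esub> f x)}"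

definition left_module_isomorphic ::
  "('a, 'r) ring_scheme \<Rightarrow> ('a, 'b, 'm) module_scheme \<Rightarrow> ('a, 'c, 'n) module_scheme \<Rightarrow> bool"
  where "left_module_isomorphic R M N \<longleftrightarrow>
    (\<exists>f\<in>left_module_hom R M N. bij_betw f (carrier M) (carrier N))"

definition internal_direct_sum ::
  "('a, 'r) ring_scheme \<Rightarrow> ('a, 'b, 'm) module_scheme \<Rightarrow> 'b set \<Rightarrow> 'b set \<Rightarrow> bool"
  where "internal_direct_sum R M U V \<longleftrightarrow>
    Module.submodule U R M \<and> Module.submodule V R M \<and>
    U \<inter> V = {\<zero>\<^bsub>M\<^esub>} \<and> set_add M U V = carrier M"

definition indecomposable :: "('a, 'r) ring_scheme \<Rightarrow> ('a, 'b, 'm) module_scheme \<Rightarrow> bool"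
  where "indecomposable R M \<longleftrightarrow>
    carrier M \<noteq> {\<zero>\<^bsub>M\<^esub>} \<and>
    (\<forall>U V. internal_direct_sum R M U V \<longrightarrow> U = {\<zero>\<^bsub>M\<^esub>} \<or> V = {\<zero>\<^bsub>M\<^esub>})"

definition free_left_module :: "('a, 'r) ring_scheme \<Rightarrow> 'x set \<Rightarrow> ('a, 'x \<Rightarrow> 'a) module"
  where "free_left_module R S =
    \<lparr>carrier = {v. (\<forall>x\<in>S. v x \<in> carrier R) \<and> (\<forall>x. x \<notin> S \<longrightarrow> v x = \<zero>\<^bsub>R\<^esub>) \<and>
        finite {x. v x \<noteq> \<zero>\<^bsub>R\<^esub>}},
     mult = undefined, one = undefined,
     zero = (\<lambda>x. \<zero>\<^bsub>R\<^esub>), add = (\<lambda>v w x. v x \<oplus>\<^bsub>R\<^esub> w x),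
     smult = (\<lambda>a v x. a \<otimes>\<^bsub>R\<^esub> v x)\<rparr>"

text \<open>Projective: isomorphic to a direct summand of a free module. It loses nothing to
  take the basis \<open>S\<close> of the free module inside the type of elements of \<open>P\<close>, because
  \<open>P\<close> is a quotient of the free module on its own carrier.\<close>

definition projective :: "('a, 'r) ring_scheme \<Rightarrow> ('a, 'b, 'm) module_scheme \<Rightarrow> bool"
  where "projective R P \<longleftrightarrow> left_module R P \<and>
    (\<exists>(S :: 'b set) U V. internal_direct_sum R (free_left_module R S) U V \<and>
       left_module_isomorphic R P ((free_left_module R S)\<lparr>carrier := U\<rparr>))"

definition principal_left_module :: "('a, 'r) ring_scheme \<Rightarrow> 'a \<Rightarrow> ('a, 'a) module"
  where "principal_left_module R e =
    \<lparr>carrier = {a \<otimes>\<^bsub>R\<^esub> e | a. a \<in> carrier R}, mult = undefined, one = undefined,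
     zero = \<zero>\<^bsub>R\<^esub>, add = (\<oplus>\<^bsub>R\<^esub>), smult = (\<otimes>\<^bsub>R\<^esub>)\<rparr>"


section \<open>Finite-dimensional algebras and their Cartan matrices\<close>

locale fin_dim_algebra = vectorspace K A + A?: ring A
    for K :: "('k, 'l) ring_scheme" (structure) and A :: "('k, 'a, 'r) module_scheme" (structure) +
  assumes fin_dim: "vectorspace.fin_dim K A"
    and smult_assoc_left:
      "\<lbrakk>c \<in> carrier K; x \<in> carrier A; y \<in> carrier A\<rbrakk> \<Longrightarrow>
        (c \<odot>\<^bsub>A\<^esub> x) \<otimes>\<^bsub>A\<^esub> y = c \<odot>\<^bsub>A\<^esub> (x \<otimes>\<^bsub>A\<^esub> y)"
    and smult_assoc_right:
      "\<lbrakk>c \<in> carrier K; x \<in> carrier A; y \<in> carrier A\<rbrakk> \<Longrightarrow>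
        x \<otimes>\<^bsub>A\<^esub> (c \<odot>\<^bsub>A\<^esub> y) = c \<odot>\<^bsub>A\<^esub> (x \<otimes>\<^bsub>A\<^esub> y)"

definition algebra_iso ::
  "('k, 'l) ring_scheme \<Rightarrow> ('k, 'a, 'm) module_scheme \<Rightarrow> ('k, 'b, 'n) module_scheme \<Rightarrow> ('a \<Rightarrow> 'b) set"
  where "algebra_iso K A B =
    {\<Phi> \<in> ring_iso A B. \<forall>c\<in>carrier K. \<forall>x\<in>carrier A. \<Phi> (c \<odot>\<^bsub>A\<^esub> x) = c \<odot>\<^bsub>B\<^esub> \<Phi> x}"

definition ring_idempotent :: "('a, 'r) ring_scheme \<Rightarrow> 'a \<Rightarrow> bool"
  where "ring_idempotent R e \<longleftrightarrow> e \<in> carrier R \<and> e \<otimes>\<^bsub>R\<^esub> e = e"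

definition primitive_idempotent :: "('a, 'r) ring_scheme \<Rightarrow> 'a \<Rightarrow> bool"
  where "primitive_idempotent R e \<longleftrightarrow> ring_idempotent R e \<and> e \<noteq> \<zero>\<^bsub>R\<^esub> \<and>
    (\<forall>f g. ring_idempotent R f \<and> ring_idempotent R g \<and>
       f \<otimes>\<^bsub>R\<^esub> g = \<zero>\<^bsub>R\<^esub> \<and> g \<otimes>\<^bsub>R\<^esub> f = \<zero>\<^bsub>R\<^esub> \<and> e = f \<oplus>\<^bsub>R\<^esub> g
       \<longrightarrow> f = \<zero>\<^bsub>R\<^esub> \<or> g = \<zero>\<^bsub>R\<^esub>)"

text \<open>The idempotents in the list \<open>es\<close> are primitive and the modules \<open>R e\<close> they generate
  represent each isomorphism class of indecomposable projective left \<open>R\<close>-modules exactly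
  once. HOL cannot quantify over types inside a formula, so the type \<open>'m\<close> of the elements
  of the competing modules is a parameter. A theorem polymorphic in \<open>'m\<close> covers all
  modules.\<close>

definition represent_indecomposable_projectives ::
  "'m itself \<Rightarrow> ('a, 'r) ring_scheme \<Rightarrow> 'a list \<Rightarrow> bool"
  where "represent_indecomposable_projectives TM R es \<longleftrightarrow>
    (\<forall>e\<in>set es. primitive_idempotent R e) \<and>
    (\<forall>i<length es. \<forall>j<length es.
       left_module_isomorphic R (principal_left_module R (es ! i)) (principal_left_module R (es ! j))
         \<longrightarrow> i = j) \<and>
    (\<forall>P :: ('a, 'm) module. projective R P \<and> indecomposable R P \<longrightarrow>
       (\<exists>i<length es. left_module_isomorphic R P (principal_left_module R (es ! i))))"

text \<open>Lists and the matrices of Jordan-Normal-Form are indexed from 0.\<close>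

definition is_cartan_matrix ::
  "'m itself \<Rightarrow> ('k, 'l) ring_scheme \<Rightarrow> ('k, 'a, 'r) module_scheme \<Rightarrow> 'a list \<Rightarrow> nat mat \<Rightarrow> bool"
  where "is_cartan_matrix TM K A es C \<longleftrightarrow>
    fin_dim_algebra K A \<and>
    represent_indecomposable_projectives TM A es \<and>
    C = mat (length es) (length es) (\<lambda>(i, j).
      vectorspace.dim K
        (A\<lparr>carrier := {es ! i \<otimes>\<^bsub>A\<^esub> a \<otimes>\<^bsub>A\<^esub> es ! j | a. a \<in> carrier A}\<rparr>))"


section \<open>Algebras of finite monoids and categories\<close>

text \<open>An element is given by its coefficient function, which vanishes outside the basis.
  Both constructions are only meant for finite monoids and finite categories.\<close>

definition basis_element :: "'b \<Rightarrow> 'b \<Rightarrow> 'k::field"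
  where "basis_element m = (\<lambda>p. if p = m then 1 else 0)"

definition monoid_algebra :: "('b, 'c) monoid_scheme \<Rightarrow> ('k::field, 'b \<Rightarrow> 'k) module"
  where "monoid_algebra G =
    \<lparr>carrier = {f. \<forall>m. m \<notin> carrier G \<longrightarrow> f m = 0},
     mult = (\<lambda>f g m. \<Sum>(p, q) | p \<in> carrier G \<and> q \<in> carrier G \<and> p \<otimes>\<^bsub>G\<^esub> q = m. f p * g q),
     one = basis_element \<one>\<^bsub>G\<^esub>,
     zero = (\<lambda>m. 0), add = (\<lambda>f g m. f m + g m), smult = (\<lambda>c f m. c * f m)\<rparr>"

record ('o, 'b) category =
  Ob :: "'o set"
  Mor :: "'b set"
  src :: "'b \<Rightarrow> 'o"
  tgt :: "'b \<Rightarrow> 'o"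
  idt :: "'o \<Rightarrow> 'b"
  cmp :: "'b \<Rightarrow> 'b \<Rightarrow> 'b"  \<comment> \<open>\<open>cmp C p q\<close> is \<open>p\<close> after \<open>q\<close>\<close>

definition category_algebra :: "('o, 'b, 'c) category_scheme \<Rightarrow> ('k::field, 'b \<Rightarrow> 'k) module"
  where "category_algebra C =
    \<lparr>carrier = {f. \<forall>m. m \<notin> Mor C \<longrightarrow> f m = 0},
     mult = (\<lambda>f g m. \<Sum>(p, q) | p \<in> Mor C \<and> q \<in> Mor C \<and> src C p = tgt C q \<and> cmp C p q = m.
       f p * g q),
     one = (\<lambda>m. \<Sum>S\<in>Ob C. basis_element (idt C S) m),
     zero = (\<lambda>m. 0), add = (\<lambda>f g m. f m + g m), smult = (\<lambda>c f m. c * f m)\<rparr>"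


section \<open>Order-preserving partial functions\<close>

definition order_preserving :: "(nat \<rightharpoonup> nat) \<Rightarrow> bool"
  where "order_preserving f \<longleftrightarrow> (\<forall>x\<in>dom f. \<forall>y\<in>dom f. x \<le> y \<longrightarrow> the (f x) \<le> the (f y))"

definition PO :: "nat \<Rightarrow> (nat \<rightharpoonup> nat) monoid"
  where "PO n =
    \<lparr>carrier = {f. dom f \<subseteq> {1..n} \<and> ran f \<subseteq> {1..n} \<and> order_preserving f},
     mult = (\<circ>\<^sub>m), one = Some |` {1..n}\<rparr>"

text \<open>A morphism \<open>A \<rightarrow> B\<close> of \<open>EO n\<close> is an order-preserving function from \<open>A\<close> onto \<open>B\<close>. As it
  is onto, it is encoded by the partial map alone, whose domain and range are \<open>A\<close> and \<open>B\<close>.\<close>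

definition EO :: "nat \<Rightarrow> (nat set, nat \<rightharpoonup> nat) category"
  where "EO n =
    \<lparr>Ob = Pow {1..n},
     Mor = {f. dom f \<in> Pow {1..n} \<and> ran f \<in> Pow {1..n} \<and> order_preserving f},
     src = dom, tgt = ran, idt = (\<lambda>A. Some |` A), cmp = (\<circ>\<^sub>m)\<rparr>"

definition EO_idempotents :: "nat \<Rightarrow> ((nat \<rightharpoonup> nat) \<Rightarrow> 'k::field) list"
  where "EO_idempotents n = map (\<lambda>k. basis_element (idt (EO n) {1..k})) [0..<n+1]"

text \<open>Only used for \<open>k \<ge> -1\<close> and \<open>m \<ge> -1\<close>, with the convention that \<open>k = -1\<close> gives 1 if
  \<open>m = -1\<close> and 0 otherwise.\<close>

definition binom :: "int \<Rightarrow> int \<Rightarrow> nat"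
  where "binom m k = (if k = -1 then (if m = -1 then 1 else 0) else nat m choose nat k)"

end

theory Submission
  imports Defs
begin

text \<open>Summing over all restrictions, \<open>f \<mapsto> \<Sum>h\<subseteq>f. h\<close>, is unitriangular with respect to the size of
  the domain and turns the monoid algebra of \<open>PO n\<close> into the category algebra of \<open>EO n\<close>.
  In the latter, \<open>card (dom m) - card (ran m)\<close> is additive under composition, so the morphisms of
  positive degree span a nilpotent ideal, and those of degree 0 are the unique order isomorphisms
  between sets of equal cardinality. Hence \<open>e A e\<close> is one-dimensional for the identity \<open>e\<close> of
  \<open>[k]\<close>, and the two-sided ideal generated by any element outside the nilpotent ideal contains one
  of these \<open>e\<close>. Given an indecomposable projective \<open>P\<close>, some coordinate map \<open>P \<rightarrow> A\<close> does not land in the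
  ideal; multiplying on the right turns it into a map onto some \<open>A e\<close>, which splits, so
  \<open>P \<cong> A e\<close>. The Cartan matrix therefore counts the order-preserving surjections
  \<open>[j] \<rightarrow> [i]\<close>, which satisfy Pascal's recursion according to whether the last fibre is a
  singleton.\<close>

section \<open>Left modules\<close>

text \<open>The classification speaks of all indecomposable projective modules, finitely generated
  or not, so a decomposition of \<open>A\<close> itself does not settle it. Nilpotency does: if
  every coordinate map of \<open>P\<close> took values in the ideal, so would the entries of an
  idempotent matrix describing \<open>P\<close>, and applying that idempotent repeatedly would push
  every element of \<open>P\<close> into ever higher powers. A family \<open>I k\<close> stands in
  for these powers, because membership can then be read off from the degree of the morphisms
  involved. Restrictions enter because \<open>PO n\<close> composes two maps wherever they meet,
  whereas in \<open>EO n\<close> domain and range must match exactly. A restriction of a composite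
  in \<open>PO n\<close> factors in exactly one way into matching restrictions of the two factors,
  and this is multiplicativity. The matrix of \<open>PO n\<close> is claimed for every isomorphism
  of the two algebras. Therefore all conditions on the idempotents are stated inside the ring, from
  where any isomorphism carries them over.\<close>

lemma (in left_module) smult_l_null:
  assumes "x \<in> carrier M" shows "\<zero>\<^bsub>R\<^esub> \<odot>\<^bsub>M\<^esub> x = \<zero>\<^bsub>M\<^esub>"
proof -
  have "\<zero>\<^bsub>R\<^esub> \<odot>\<^bsub>M\<^esub> x \<oplus>\<^bsub>M\<^esub> \<zero>\<^bsub>R\<^esub> \<odot>\<^bsub>M\<^esub> x = \<zero>\<^bsub>R\<^esub> \<odot>\<^bsub>M\<^esub> x"
    using smult_l_distr[of "\<zero>\<^bsub>R\<^esub>" "\<zero>\<^bsub>R\<^esub>" x] assms by simp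
  then show ?thesis
    using M.add.l_cancel_one[of "\<zero>\<^bsub>R\<^esub> \<odot>\<^bsub>M\<^esub> x" "\<zero>\<^bsub>R\<^esub> \<odot>\<^bsub>M\<^esub> x"] assms smult_closed by auto
qed

lemma (in left_module) smult_l_minus:
  assumes "a \<in> carrier R" "x \<in> carrier M"
  shows "(\<ominus>\<^bsub>R\<^esub> a) \<odot>\<^bsub>M\<^esub> x = \<ominus>\<^bsub>M\<^esub> (a \<odot>\<^bsub>M\<^esub> x)"
proof -
  have "(\<ominus>\<^bsub>R\<^esub> a) \<odot>\<^bsub>M\<^esub> x \<oplus>\<^bsub>M\<^esub> a \<odot>\<^bsub>M\<^esub> x = \<zero>\<^bsub>M\<^esub>"
    using smult_l_distr[of "\<ominus>\<^bsub>R\<^esub> a" a x] assms smult_l_null by (simp add: R.l_neg)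
  then show ?thesis
    using assms smult_closed M.minus_equality by simp
qed

lemma (in left_module) submoduleI:
  assumes "H \<subseteq> carrier M" "\<zero>\<^bsub>M\<^esub> \<in> H"
    and "\<And>x y. x \<in> H \<Longrightarrow> y \<in> H \<Longrightarrow> x \<oplus>\<^bsub>M\<^esub> y \<in> H"
    and sm: "\<And>a x. a \<in> carrier R \<Longrightarrow> x \<in> H \<Longrightarrow> a \<odot>\<^bsub>M\<^esub> x \<in> H"
  shows "Module.submodule H R M"
proof -
  have "\<ominus>\<^bsub>M\<^esub> x \<in> H" if "x \<in> H" for x
    using sm[of "\<ominus>\<^bsub>R\<^esub> \<one>\<^bsub>R\<^esub>" x] smult_l_minus[of "\<one>\<^bsub>R\<^esub>" x] smult_one that assms(1) by auto
  then have "subgroup H (add_monoid M)"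
    using assms by (intro M.add.subgroupI) (auto simp: a_inv_def)
  then show ?thesis
    using sm by (simp add: Module.submodule_def submodule_axioms_def)
qed

lemma (in left_module) submoduleD:
  assumes "Module.submodule H R M"
  shows "H \<subseteq> carrier M" "\<zero>\<^bsub>M\<^esub> \<in> H"
    and "\<And>x y. x \<in> H \<Longrightarrow> y \<in> H \<Longrightarrow> x \<oplus>\<^bsub>M\<^esub> y \<in> H"
    and "\<And>x. x \<in> H \<Longrightarrow> \<ominus>\<^bsub>M\<^esub> x \<in> H"
    and "\<And>a x. a \<in> carrier R \<Longrightarrow> x \<in> H \<Longrightarrow> a \<odot>\<^bsub>M\<^esub> x \<in> H"
proof -
  interpret Module.submodule H R M by fact
  show "H \<subseteq> carrier M" "\<zero>\<^bsub>M\<^esub> \<in> H"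
    and "\<And>x y. x \<in> H \<Longrightarrow> y \<in> H \<Longrightarrow> x \<oplus>\<^bsub>M\<^esub> y \<in> H"
    and "\<And>a x. a \<in> carrier R \<Longrightarrow> x \<in> H \<Longrightarrow> a \<odot>\<^bsub>M\<^esub> x \<in> H"
    using subset one_closed m_closed smult_closed by auto
  show "\<And>x. x \<in> H \<Longrightarrow> \<ominus>\<^bsub>M\<^esub> x \<in> H"
    using M.add.subgroupE(3)[OF subgroup_axioms] by (simp add: a_inv_def)
qed

section \<open>Homomorphisms, principal modules, free modules and direct summands\<close>

lemma left_module_homD:
  assumes "f \<in> left_module_hom R M N"
  shows "\<And>x. x \<in> carrier M \<Longrightarrow> f x \<in> carrier N"
    and "\<And>x y. x \<in> carrier M \<Longrightarrow> y \<in> carrier M \<Longrightarrow> f (x \<oplus>\<^bsub>M\<^esub> y) = f x \<oplus>\<^bsub>N\<^esub> f y"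
    and "\<And>a x. a \<in> carrier R \<Longrightarrow> x \<in> carrier M \<Longrightarrow> f (a \<odot>\<^bsub>M\<^esub> x) = a \<odot>\<^bsub>N\<^esub> f x"
  using assms by (auto simp: left_module_hom_def)

lemma left_module_hom_zero:
  assumes "left_module R M" "left_module R N" "f \<in> left_module_hom R M N"
  shows "f \<zero>\<^bsub>M\<^esub> = \<zero>\<^bsub>N\<^esub>"
proof -
  interpret M: left_module R M by fact
  interpret N: left_module R N by fact
  have "f (\<zero>\<^bsub>R\<^esub> \<odot>\<^bsub>M\<^esub> \<zero>\<^bsub>M\<^esub>) = \<zero>\<^bsub>R\<^esub> \<odot>\<^bsub>N\<^esub> f \<zero>\<^bsub>M\<^esub>"
    using assms(3) by (simp add: left_module_homD)
  then show ?thesis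
    using M.smult_l_null N.smult_l_null left_module_homD(1)[OF assms(3)] by simp
qed

lemma (in ring) left_module_principal:
  assumes "e \<in> carrier R"
  shows "left_module R (principal_left_module R e)"
proof (intro left_module.intro left_module_axioms.intro)
  let ?M = "principal_left_module R e"
  have sub: "carrier ?M \<subseteq> carrier R" "\<zero> \<in> carrier ?M"
    using assms l_null[of e] by (auto simp: principal_left_module_def intro!: exI[of _ \<zero>])
  have add: "x \<oplus> y \<in> carrier ?M" if "x \<in> carrier ?M" "y \<in> carrier ?M" for x y
    using that assms by (auto simp: principal_left_module_def) (metis l_distr a_closed)
  have neg: "\<exists>y\<in>carrier ?M. y \<oplus> x = \<zero>" if x: "x \<in> carrier ?M" for x
  proof -
    obtain a where "a \<in> carrier R" "x = a \<otimes> e"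
      using x by (auto simp: principal_left_module_def)
    then have "(\<ominus> a) \<otimes> e \<in> carrier ?M" "(\<ominus> a) \<otimes> e \<oplus> x = \<zero>"
      using assms a_inv_closed[of a] unfolding principal_left_module_def
      by (auto simp: l_minus l_neg intro!: exI[of _ "\<ominus> a"])
    then show ?thesis by blast
  qed
  show "ring R" by (rule ring_axioms)
  show "abelian_group ?M"
  proof (rule abelian_groupI)
    show "\<zero>\<^bsub>?M\<^esub> \<in> carrier ?M" using sub by (simp add: principal_left_module_def)
    show "\<exists>y\<in>carrier ?M. y \<oplus>\<^bsub>?M\<^esub> x = \<zero>\<^bsub>?M\<^esub>" if "x \<in> carrier ?M" for x
      using neg[OF that] by (simp add: principal_left_module_def)
  qed (use assms add in \<open>auto simp: principal_left_module_def a_ac\<close>)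
  show "a \<odot>\<^bsub>?M\<^esub> x \<in> carrier ?M" if "a \<in> carrier R" "x \<in> carrier ?M" for a x
    using that assms by (auto simp: principal_left_module_def) (metis m_assoc m_closed)
qed (use assms in \<open>auto simp: principal_left_module_def l_distr r_distr m_assoc\<close>)

lemma (in ring) left_module_free: "left_module R (free_left_module R S)"
proof (intro left_module.intro left_module_axioms.intro)
  let ?F = "free_left_module R S"
  have car: "v x \<in> carrier R" if "v \<in> carrier ?F" for v x
    using that zero_closed by (cases "x \<in> S") (auto simp: free_left_module_def)
  have sel: "\<zero>\<^bsub>?F\<^esub> = (\<lambda>x. \<zero>)" "\<And>v w. v \<oplus>\<^bsub>?F\<^esub> w = (\<lambda>x. v x \<oplus> w x)"
    "\<And>a v. a \<odot>\<^bsub>?F\<^esub> v = (\<lambda>x. a \<otimes> v x)"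
    by (simp_all add: free_left_module_def)
  have add: "(\<lambda>x. v x \<oplus> w x) \<in> carrier ?F" if "v \<in> carrier ?F" "w \<in> carrier ?F" for v w
  proof -
    have "{x. v x \<oplus> w x \<noteq> \<zero>} \<subseteq> {x. v x \<noteq> \<zero>} \<union> {x. w x \<noteq> \<zero>}" by auto
    then have "finite {x. v x \<oplus> w x \<noteq> \<zero>}"
      using that by (elim finite_subset) (auto simp: free_left_module_def)
    then show ?thesis
      using that car[OF that(1)] car[OF that(2)] by (auto simp: free_left_module_def)
  qed
  have smult: "(\<lambda>x. a \<otimes> v x) \<in> carrier ?F" if "a \<in> carrier R" "v \<in> carrier ?F" for a v
  proof -
    have "{x. a \<otimes> v x \<noteq> \<zero>} \<subseteq> {x. v x \<noteq> \<zero>}" using that by auto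
    then have "finite {x. a \<otimes> v x \<noteq> \<zero>}"
      using that by (elim finite_subset) (auto simp: free_left_module_def)
    then show ?thesis
      using that car[OF that(2)] by (auto simp: free_left_module_def)
  qed
  have neg: "\<exists>w\<in>carrier ?F. w \<oplus>\<^bsub>?F\<^esub> v = \<zero>\<^bsub>?F\<^esub>" if "v \<in> carrier ?F" for v
    using smult[of "\<ominus> \<one>" v] car[OF that] that
    by (intro bexI[of _ "\<lambda>x. (\<ominus> \<one>) \<otimes> v x"]) (auto simp: free_left_module_def l_minus l_neg)
  show "ring R" by (rule ring_axioms)
  show "abelian_group ?F"
  proof (rule abelian_groupI)
    show "\<exists>y\<in>carrier ?F. y \<oplus>\<^bsub>?F\<^esub> x = \<zero>\<^bsub>?F\<^esub>" if "x \<in> carrier ?F" for x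
      using neg[OF that] .
    show "\<zero>\<^bsub>?F\<^esub> \<in> carrier ?F" by (simp add: free_left_module_def)
  qed (auto simp: sel add car a_ac)
  show "a \<odot>\<^bsub>?F\<^esub> v \<in> carrier ?F" if "a \<in> carrier R" "v \<in> carrier ?F" for a v
    using smult[OF that] by (simp add: free_left_module_def)
  show "(a \<oplus> b) \<odot>\<^bsub>?F\<^esub> v = a \<odot>\<^bsub>?F\<^esub> v \<oplus>\<^bsub>?F\<^esub> b \<odot>\<^bsub>?F\<^esub> v"
    if "a \<in> carrier R" "b \<in> carrier R" "v \<in> carrier ?F" for a b v
    using that by (simp add: sel car l_distr)
  show "a \<odot>\<^bsub>?F\<^esub> (v \<oplus>\<^bsub>?F\<^esub> w) = a \<odot>\<^bsub>?F\<^esub> v \<oplus>\<^bsub>?F\<^esub> a \<odot>\<^bsub>?F\<^esub> w"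
    if "a \<in> carrier R" "v \<in> carrier ?F" "w \<in> carrier ?F" for a v w
    using that by (simp add: sel car r_distr)
  show "(a \<otimes> b) \<odot>\<^bsub>?F\<^esub> v = a \<odot>\<^bsub>?F\<^esub> (b \<odot>\<^bsub>?F\<^esub> v)"
    if "a \<in> carrier R" "b \<in> carrier R" "v \<in> carrier ?F" for a b v
    using that by (simp add: sel car m_assoc)
  show "\<one> \<odot>\<^bsub>?F\<^esub> v = v" if "v \<in> carrier ?F" for v
    using that by (simp add: sel car)
qed

text \<open>This is the projection onto \<open>U\<close> along \<open>V\<close>, well defined
  because two decompositions of an element differ by an element of \<open>U \<inter> V\<close>. It
  lets a projective module be handled as the set of fixed points of an endomorphism of a free
  module.\<close>

lemma summand_projection:
  assumes "left_module R M" "internal_direct_sum R M U V"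
  obtains p where "p \<in> left_module_hom R M M" "\<And>x. x \<in> carrier M \<Longrightarrow> p x \<in> U"
    "\<And>x. x \<in> U \<Longrightarrow> p x = x"
proof -
  interpret left_module R M by fact
  have U: "Module.submodule U R M" and V: "Module.submodule V R M"
    and int: "U \<inter> V = {\<zero>\<^bsub>M\<^esub>}" and sum: "set_add M U V = carrier M"
    using assms(2) by (auto simp: internal_direct_sum_def)
  note UD = submoduleD[OF U] and VD = submoduleD[OF V]
  have uniq: "u = u'" if "u \<in> U" "u' \<in> U" "v \<in> V" "v' \<in> V" "u \<oplus>\<^bsub>M\<^esub> v = u' \<oplus>\<^bsub>M\<^esub> v'" for u u' v v'
  proof -
    have c: "u \<in> carrier M" "u' \<in> carrier M" "v \<in> carrier M" "v' \<in> carrier M"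
      using that UD(1) VD(1) by auto
    have swap: "(a \<oplus>\<^bsub>M\<^esub> b) \<oplus>\<^bsub>M\<^esub> (c \<oplus>\<^bsub>M\<^esub> d) = (a \<oplus>\<^bsub>M\<^esub> c) \<oplus>\<^bsub>M\<^esub> (b \<oplus>\<^bsub>M\<^esub> d)"
      if "a \<in> carrier M" "b \<in> carrier M" "c \<in> carrier M" "d \<in> carrier M" for a b c d
      using that by (simp add: M.a_ac)
    \<comment> \<open>Adding \<open>-u' - v\<close> to both expressions for the same element leaves
      a difference in \<open>U\<close> on one side and a difference in \<open>V\<close> on the
      other.\<close>
    have "(u \<oplus>\<^bsub>M\<^esub> v) \<oplus>\<^bsub>M\<^esub> (\<ominus>\<^bsub>M\<^esub> u' \<oplus>\<^bsub>M\<^esub> \<ominus>\<^bsub>M\<^esub> v) = u \<oplus>\<^bsub>M\<^esub> \<ominus>\<^bsub>M\<^esub> u'"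
      using c swap[of u v "\<ominus>\<^bsub>M\<^esub> u'" "\<ominus>\<^bsub>M\<^esub> v"] by (simp add: M.r_neg)
    moreover have "(u' \<oplus>\<^bsub>M\<^esub> v') \<oplus>\<^bsub>M\<^esub> (\<ominus>\<^bsub>M\<^esub> u' \<oplus>\<^bsub>M\<^esub> \<ominus>\<^bsub>M\<^esub> v) = v' \<oplus>\<^bsub>M\<^esub> \<ominus>\<^bsub>M\<^esub> v"
      using c swap[of u' v' "\<ominus>\<^bsub>M\<^esub> u'" "\<ominus>\<^bsub>M\<^esub> v"] by (simp add: M.r_neg)
    ultimately have "u \<oplus>\<^bsub>M\<^esub> \<ominus>\<^bsub>M\<^esub> u' = v' \<oplus>\<^bsub>M\<^esub> \<ominus>\<^bsub>M\<^esub> v"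
      using that(5) by simp
    moreover have "u \<oplus>\<^bsub>M\<^esub> \<ominus>\<^bsub>M\<^esub> u' \<in> U" "v' \<oplus>\<^bsub>M\<^esub> \<ominus>\<^bsub>M\<^esub> v \<in> V"
      using that UD VD by auto
    ultimately have "u \<oplus>\<^bsub>M\<^esub> \<ominus>\<^bsub>M\<^esub> u' = \<zero>\<^bsub>M\<^esub>" using int by auto
    then show ?thesis using c M.minus_equality[of u "\<ominus>\<^bsub>M\<^esub> u'"] M.minus_minus by simp
  qed
  define p where "p x = (THE u. u \<in> U \<and> (\<exists>v\<in>V. x = u \<oplus>\<^bsub>M\<^esub> v))" for x
  have pI: "p (u \<oplus>\<^bsub>M\<^esub> v) = u" if "u \<in> U" "v \<in> V" for u v
    unfolding p_def by (rule the_equality) (use that uniq in blast)+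
  have dec: "\<exists>u\<in>U. \<exists>v\<in>V. x = u \<oplus>\<^bsub>M\<^esub> v" if "x \<in> carrier M" for x
    using sum that unfolding set_add_def' by blast
  show thesis
  proof
    show pU: "p x \<in> U" if "x \<in> carrier M" for x
      using dec[OF that] pI by auto
    show "p x = x" if "x \<in> U" for x
      using pI[OF that VD(2)] UD(1) that by auto
    show "p \<in> left_module_hom R M M"
      unfolding left_module_hom_def
    proof (intro CollectI conjI ballI)
      show "p \<in> carrier M \<rightarrow> carrier M" using pU UD(1) by auto
      fix x y assume "x \<in> carrier M" "y \<in> carrier M"
      then obtain u v u' v' where uv: "u \<in> U" "v \<in> V" "x = u \<oplus>\<^bsub>M\<^esub> v" "u' \<in> U" "v' \<in> V" "y = u' \<oplus>\<^bsub>M\<^esub> v'"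
        using dec by metis
      then have "x \<oplus>\<^bsub>M\<^esub> y = (u \<oplus>\<^bsub>M\<^esub> u') \<oplus>\<^bsub>M\<^esub> (v \<oplus>\<^bsub>M\<^esub> v')"
        using UD(1) VD(1) by (simp add: subset_iff M.a_ac)
      then show "p (x \<oplus>\<^bsub>M\<^esub> y) = p x \<oplus>\<^bsub>M\<^esub> p y"
        using uv pI UD(3) VD(3) by simp
    next
      fix a x assume a: "a \<in> carrier R" and "x \<in> carrier M"
      then obtain u v where uv: "u \<in> U" "v \<in> V" "x = u \<oplus>\<^bsub>M\<^esub> v"
        using dec by metis
      then have "a \<odot>\<^bsub>M\<^esub> x = a \<odot>\<^bsub>M\<^esub> u \<oplus>\<^bsub>M\<^esub> a \<odot>\<^bsub>M\<^esub> v"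
        using UD(1) VD(1) a by (simp add: subset_iff smult_r_distr)
      then show "p (a \<odot>\<^bsub>M\<^esub> x) = a \<odot>\<^bsub>M\<^esub> p x"
        using uv a pI UD(5) VD(5) by simp
    qed
  qed
qed

text \<open>A surjection onto \<open>R e\<close> splits.\<close>

lemma indecomposable_isomorphic_principal:
  assumes "left_module R P" "indecomposable R P"
    and e: "ring_idempotent R e" "e \<noteq> \<zero>\<^bsub>R\<^esub>"
    and f: "f \<in> left_module_hom R P (principal_left_module R e)"
    and x0: "x0 \<in> carrier P" "f x0 = e"
  shows "left_module_isomorphic R P (principal_left_module R e)"
proof -
  interpret left_module R P by fact
  let ?Re = "principal_left_module R e"
  note f0 = left_module_hom_zero[OF assms(1) R.left_module_principal f]
  have ec: "e \<in> carrier R" "e \<otimes>\<^bsub>R\<^esub> e = e" using e by (auto simp: ring_idempotent_def)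
  have fc: "f y \<in> carrier R" "f y \<otimes>\<^bsub>R\<^esub> e = f y" if "y \<in> carrier P" for y
    using left_module_homD(1)[OF f that] ec by (auto simp: principal_left_module_def R.m_assoc)
  have fadd: "f (y \<oplus>\<^bsub>P\<^esub> z) = f y \<oplus>\<^bsub>R\<^esub> f z" if "y \<in> carrier P" "z \<in> carrier P" for y z
    using left_module_homD(2)[OF f that] by (simp add: principal_left_module_def)
  have fsm: "f (a \<odot>\<^bsub>P\<^esub> y) = a \<otimes>\<^bsub>R\<^esub> f y" if "a \<in> carrier R" "y \<in> carrier P" for a y
    using left_module_homD(3)[OF f that] by (simp add: principal_left_module_def)
  have fz: "f \<zero>\<^bsub>P\<^esub> = \<zero>\<^bsub>R\<^esub>"
    using f0 ec by (simp add: principal_left_module_def)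
  \<comment> \<open>The preimage \<open>x0\<close> of \<open>e\<close> is replaced by
    \<open>e x0\<close>, which is fixed by \<open>e\<close>. Then \<open>a e \<mapsto> a x\<close>
    is a section of \<open>f\<close>, with image \<open>U\<close>.\<close>
  define x where "x = e \<odot>\<^bsub>P\<^esub> x0"
  have x: "x \<in> carrier P" "f x = e" "e \<odot>\<^bsub>P\<^esub> x = x"
    using x0 ec fsm smult_closed smult_assoc1[of e e x0] by (auto simp: x_def)
  define U where "U = {a \<odot>\<^bsub>P\<^esub> x | a. a \<in> carrier R}"
  define V where "V = {y \<in> carrier P. f y = \<zero>\<^bsub>R\<^esub>}"
  have "Module.submodule U R P"
  proof (rule submoduleI)
    show "U \<subseteq> carrier P" using x smult_closed by (auto simp: U_def)
    show "\<zero>\<^bsub>P\<^esub> \<in> U" using smult_l_null[OF x(1)] R.zero_closed unfolding U_def by force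
    fix y z assume "y \<in> U" "z \<in> U"
    then show "y \<oplus>\<^bsub>P\<^esub> z \<in> U"
      using x(1) unfolding U_def by clarsimp (metis smult_l_distr R.a_closed)
  next
    fix a y assume "a \<in> carrier R" "y \<in> U"
    then show "a \<odot>\<^bsub>P\<^esub> y \<in> U"
      using x(1) unfolding U_def by clarsimp (metis smult_assoc1 R.m_closed)
  qed
  moreover have "Module.submodule V R P"
    by (rule submoduleI) (auto simp: V_def fz fadd fsm smult_closed)
  moreover have "U \<inter> V = {\<zero>\<^bsub>P\<^esub>}"
  proof -
    have "a \<odot>\<^bsub>P\<^esub> x = \<zero>\<^bsub>P\<^esub>" if a: "a \<in> carrier R" "f (a \<odot>\<^bsub>P\<^esub> x) = \<zero>\<^bsub>R\<^esub>" for a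
    proof -
      have "a \<otimes>\<^bsub>R\<^esub> e = \<zero>\<^bsub>R\<^esub>" using a x fsm by simp
      then show ?thesis
        using smult_assoc1[of a e x] smult_l_null[of x] a x ec by simp
    qed
    moreover have "\<zero>\<^bsub>P\<^esub> \<in> U" "\<zero>\<^bsub>P\<^esub> \<in> V"
      using calculation submoduleD(2) \<open>Module.submodule U R P\<close> \<open>Module.submodule V R P\<close> by auto
    ultimately show ?thesis by (auto simp: U_def V_def)
  qed
  moreover have "set_add P U V = carrier P"
  proof (intro equalityI subsetI)
    fix y assume "y \<in> set_add P U V"
    then show "y \<in> carrier P"
      using x smult_closed by (auto simp: set_add_def' U_def V_def)
  next
    fix y assume y: "y \<in> carrier P"
    \<comment> \<open>Since \<open>f (f y x) = f y e = f y\<close>, subtracting \<open>f y x\<close>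
      from \<open>y\<close> leaves an element of the kernel \<open>V\<close>.\<close>
    let ?u = "f y \<odot>\<^bsub>P\<^esub> x" and ?v = "y \<oplus>\<^bsub>P\<^esub> (\<ominus>\<^bsub>R\<^esub> f y) \<odot>\<^bsub>P\<^esub> x"
    have u: "?u \<in> U" "?u \<in> carrier P" using y fc x smult_closed by (auto simp: U_def)
    have "f ?v = f y \<oplus>\<^bsub>R\<^esub> (\<ominus>\<^bsub>R\<^esub> f y) \<otimes>\<^bsub>R\<^esub> e"
      using y fc x smult_closed by (simp add: fadd fsm)
    also have "\<dots> = \<zero>\<^bsub>R\<^esub>" using fc[OF y] ec by (simp add: R.l_minus R.r_neg)
    finally have "?v \<in> V" using y fc x smult_closed by (auto simp: V_def)
    moreover have "y = ?u \<oplus>\<^bsub>P\<^esub> ?v"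
      using u y fc x by (simp add: smult_l_minus M.a_lcomm[of "f y \<odot>\<^bsub>P\<^esub> x" y] M.r_neg)
    ultimately show "y \<in> set_add P U V" using u by (auto simp: set_add_def')
  qed
  ultimately have "U = {\<zero>\<^bsub>P\<^esub>} \<or> V = {\<zero>\<^bsub>P\<^esub>}"
    using assms(2) unfolding indecomposable_def internal_direct_sum_def by blast
  \<comment> \<open>\<open>U\<close> contains \<open>x\<close>, whose image \<open>e\<close> is
    nonzero, so indecomposability forces the kernel \<open>V\<close> to vanish.\<close>
  moreover have "U \<noteq> {\<zero>\<^bsub>P\<^esub>}"
  proof
    assume "U = {\<zero>\<^bsub>P\<^esub>}"
    moreover have "e \<odot>\<^bsub>P\<^esub> x \<in> U" using ec by (auto simp: U_def)
    ultimately have "x = \<zero>\<^bsub>P\<^esub>" using x by simp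
    then show False using x fz e by simp
  qed
  ultimately have V: "V = {\<zero>\<^bsub>P\<^esub>}" by simp
  have "inj_on f (carrier P)"
  proof (rule inj_onI)
    fix y z assume yz: "y \<in> carrier P" "z \<in> carrier P" "f y = f z"
    let ?z = "(\<ominus>\<^bsub>R\<^esub> \<one>\<^bsub>R\<^esub>) \<odot>\<^bsub>P\<^esub> z"
    have "f (y \<oplus>\<^bsub>P\<^esub> ?z) = f z \<oplus>\<^bsub>R\<^esub> (\<ominus>\<^bsub>R\<^esub> \<one>\<^bsub>R\<^esub>) \<otimes>\<^bsub>R\<^esub> f z"
      using yz smult_closed by (simp add: fadd fsm)
    also have "\<dots> = \<zero>\<^bsub>R\<^esub>" using fc yz by (simp add: R.l_minus R.r_neg)
    finally have "y \<oplus>\<^bsub>P\<^esub> ?z \<in> V" using yz smult_closed by (auto simp: V_def)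
    then have "y \<oplus>\<^bsub>P\<^esub> \<ominus>\<^bsub>P\<^esub> z = \<zero>\<^bsub>P\<^esub>" using V yz smult_l_minus smult_one by auto
    then show "y = z" using yz M.minus_equality[of y "\<ominus>\<^bsub>P\<^esub> z"] M.minus_minus by simp
  qed
  moreover have "f ` carrier P = carrier ?Re"
  proof (intro equalityI subsetI)
    fix b assume "b \<in> carrier ?Re"
    then obtain a where "a \<in> carrier R" "b = a \<otimes>\<^bsub>R\<^esub> e" by (auto simp: principal_left_module_def)
    then have "b = f (a \<odot>\<^bsub>P\<^esub> x)" "a \<odot>\<^bsub>P\<^esub> x \<in> carrier P" using x fsm smult_closed by auto
    then show "b \<in> f ` carrier P" by blast
  qed (use left_module_homD(1)[OF f] in blast)
  ultimately show ?thesis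
    using f by (auto simp: left_module_isomorphic_def bij_betw_def)
qed

section \<open>Indecomposable projectives over a ring with a nilpotent ideal\<close>

text \<open>For the generator \<open>\<one>\<close> the principal module is the regular module, the
  target of the coordinate maps.\<close>

lemma principal_one_simps:
  assumes "ring R"
  shows "carrier (principal_left_module R \<one>\<^bsub>R\<^esub>) = carrier R"
    and "\<zero>\<^bsub>principal_left_module R e\<^esub> = \<zero>\<^bsub>R\<^esub>"
    and "x \<oplus>\<^bsub>principal_left_module R e\<^esub> y = x \<oplus>\<^bsub>R\<^esub> y"
    and "a \<odot>\<^bsub>principal_left_module R e\<^esub> x = a \<otimes>\<^bsub>R\<^esub> x"
proof -
  interpret ring R by fact
  show "carrier (principal_left_module R \<one>\<^bsub>R\<^esub>) = carrier R"
    by (auto simp: principal_left_module_def) (metis r_one)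
qed (simp_all add: principal_left_module_def)

text \<open>The sets \<open>I k\<close> play the role of the powers of a nilpotent ideal \<open>I 1\<close>, and the next lemma
  is Nakayama's lemma for the possibly infinitely generated module \<open>P\<close>.\<close>

lemma projective_not_into_nilpotent:
  fixes R (structure) and P :: "('a, 'p, 'z) module_scheme"
  assumes "ring R" and P: "projective R P" "carrier P \<noteq> {\<zero>\<^bsub>P\<^esub>}"
    and I0: "I 0 = carrier R" and IN: "I N = {\<zero>}"
    and Izero: "\<And>k. \<zero> \<in> I k"
    and Iadd: "\<And>k a b. a \<in> I k \<Longrightarrow> b \<in> I k \<Longrightarrow> a \<oplus> b \<in> I k"
    and Imult: "\<And>k a b. a \<in> I k \<Longrightarrow> b \<in> I 1 \<Longrightarrow> a \<otimes> b \<in> I (Suc k)"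
  shows "\<exists>f\<in>left_module_hom R P (principal_left_module R \<one>). \<exists>x\<in>carrier P. f x \<notin> I 1"
proof (rule ccontr)
  assume "\<not> ?thesis"
  then have into: "f x \<in> I 1" if "f \<in> left_module_hom R P (principal_left_module R \<one>)" "x \<in> carrier P" for f x
    using that by blast
  interpret ring R by fact
  obtain S :: "'p set" and U V where ids: "internal_direct_sum R (free_left_module R S) U V"
    and iso: "left_module_isomorphic R P ((free_left_module R S)\<lparr>carrier := U\<rparr>)"
    and lm: "left_module R P"
    using P(1) unfolding projective_def by blast
  interpret P: left_module R P by fact
  let ?F = "free_left_module R S"
  interpret F: left_module R ?F by (rule left_module_free)
  have sel: "\<zero>\<^bsub>?F\<^esub> = (\<lambda>x. \<zero>)" "\<And>v w. v \<oplus>\<^bsub>?F\<^esub> w = (\<lambda>x. v x \<oplus> w x)"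
    "\<And>a v. a \<odot>\<^bsub>?F\<^esub> v = (\<lambda>x. a \<otimes> v x)"
    by (simp_all add: free_left_module_def)
  have car: "v x \<in> carrier R" if "v \<in> carrier ?F" for v x
    using that zero_closed by (cases "x \<in> S") (auto simp: free_left_module_def)
  obtain g where g: "g \<in> left_module_hom R P (?F\<lparr>carrier := U\<rparr>)" "bij_betw g (carrier P) U"
    using iso by (auto simp: left_module_isomorphic_def)
  obtain p where p: "p \<in> left_module_hom R ?F ?F" "\<And>x. x \<in> carrier ?F \<Longrightarrow> p x \<in> U"
    "\<And>x. x \<in> U \<Longrightarrow> p x = x"
    using summand_projection[OF left_module_free ids] by metis
  have UF: "U \<subseteq> carrier ?F"
    using ids F.submoduleD(1) by (auto simp: internal_direct_sum_def)
  \<comment> \<open>Each coordinate of \<open>U\<close>, read on \<open>P\<close> through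
    \<open>g\<close>, is a homomorphism into the regular module, so the assumption for contradiction
    applies to it.\<close>
  have U1: "u s \<in> I 1" if u: "u \<in> U" for u s
  proof -
    obtain x where x: "x \<in> carrier P" "u = g x"
      using u g(2) by (auto simp: bij_betw_def)
    have "(\<lambda>x. g x s) \<in> left_module_hom R P (principal_left_module R \<one>)"
      using g(1) UF car principal_one_simps[OF \<open>ring R\<close>]
      by (auto simp: left_module_hom_def sel Pi_iff subset_iff)
    then show ?thesis using into x by auto
  qed
  \<comment> \<open>\<open>p u\<close> is the sum of the \<open>u t p b\<close>, with
    \<open>b\<close> the basis vector at \<open>t\<close>. As \<open>p b\<close> lies in
    \<open>U\<close>, its entries are in \<open>I 1\<close>, and every product gains one level. The
    claim concerns all of the free module, because splitting off a basis vector leads out of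
    \<open>U\<close>; the induction runs over a finite set containing the support.\<close>
  have "\<forall>u\<in>carrier ?F. {x. u x \<noteq> \<zero>} \<subseteq> T \<longrightarrow> (\<forall>s. u s \<in> I k) \<longrightarrow> (\<forall>s. p u s \<in> I (Suc k))"
    if "finite T" for T k
    using that
  proof induction
    case empty
    have "p u s = \<zero>" if "\<forall>x. u x = \<zero>" for u s
    proof -
      have "u = \<zero>\<^bsub>?F\<^esub>" using that by (auto simp: sel)
      then show ?thesis
        using left_module_hom_zero[OF left_module_free left_module_free p(1)] by (simp add: sel)
    qed
    then show ?case using Izero by auto
  next
    case (insert t T)
    show ?case
    proof (intro ballI impI allI)
      fix u s
      assume u: "u \<in> carrier ?F" and supp: "{x. u x \<noteq> \<zero>} \<subseteq> insert t T" and Ik: "\<forall>s. u s \<in> I k"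
      show "p u s \<in> I (Suc k)"
      proof (cases "t \<in> S")
        \<comment> \<open>Outside \<open>S\<close> there is no basis vector to split off, but the
          coordinate is zero there.\<close>
        case False
        then have "u t = \<zero>" using u by (auto simp: free_left_module_def)
        then have "{x. u x \<noteq> \<zero>} \<subseteq> T" using supp by auto
        then show ?thesis using insert.IH u Ik by blast
      next
        case True
        define b where "b = (\<lambda>x. if x = t then \<one> else \<zero>)"
        define w where "w = (\<lambda>x. if x = t then \<zero> else u x)"
        have b: "b \<in> carrier ?F" using True by (auto simp: b_def free_left_module_def)
        have "{x. w x \<noteq> \<zero>} \<subseteq> {x. u x \<noteq> \<zero>}" by (auto simp: w_def)
        then have "finite {x. w x \<noteq> \<zero>}"
          using u by (elim finite_subset) (simp add: free_left_module_def)
        moreover have "\<forall>x\<in>S. w x \<in> carrier R" "\<forall>x. x \<notin> S \<longrightarrow> w x = \<zero>"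
          using u by (auto simp: w_def free_left_module_def)
        ultimately have w: "w \<in> carrier ?F" by (simp add: free_left_module_def)
        have "u = u t \<odot>\<^bsub>?F\<^esub> b \<oplus>\<^bsub>?F\<^esub> w"
          using car[OF u] by (auto simp: sel b_def w_def)
        then have "p u = u t \<odot>\<^bsub>?F\<^esub> p b \<oplus>\<^bsub>?F\<^esub> p w"
          using left_module_homD[OF p(1)] b w car[OF u] F.smult_closed by metis
        moreover have "p w s \<in> I (Suc k)"
        proof -
          have "{x. w x \<noteq> \<zero>} \<subseteq> T" "\<forall>s. w s \<in> I k" using supp Ik Izero by (auto simp: w_def)
          then show ?thesis using insert.IH w by blast
        qed
        moreover have "u t \<otimes> p b s \<in> I (Suc k)"
          using Imult Ik U1 p(2) b by blast
        ultimately show ?thesis using Iadd by (simp add: sel)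
      qed
    qed
  qed
  note step = this
  \<comment> \<open>Elements of \<open>U\<close> are fixed by \<open>p\<close>, so the gain of one
    level can be repeated until \<open>I N = {\<zero>}\<close> is reached.\<close>
  have "\<forall>u\<in>U. \<forall>s. u s \<in> I k" for k
  proof (induction k)
    case 0
    then show ?case using UF car I0 by auto
  next
    case (Suc k)
    have "finite {x. u x \<noteq> \<zero>}" if "u \<in> U" for u
      using that UF by (auto simp: free_left_module_def)
    then have "p u s \<in> I (Suc k)" if "u \<in> U" for u s
      using step Suc that UF by blast
    then show ?case using p(3) by auto
  qed
  from this[of N] have U0: "u = (\<lambda>x. \<zero>)" if "u \<in> U" for u using IN that by auto
  have gU: "g x \<in> U" if "x \<in> carrier P" for x
    using g(2) that by (auto simp: bij_betw_def)
  have "g x = g y" if "x \<in> carrier P" "y \<in> carrier P" for x y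
    using U0[OF gU[OF that(1)]] U0[OF gU[OF that(2)]] by simp
  then have "x = \<zero>\<^bsub>P\<^esub>" if "x \<in> carrier P" for x
    using inj_onD[OF bij_betw_imp_inj_on[OF g(2)]] that P.zero_closed by blast
  then show False using P(2) P.zero_closed by blast
qed

text \<open>An isomorphism \<open>h\<close> is right multiplication by \<open>x = h e\<close>. If
  \<open>y\<close> is the preimage of \<open>f\<close>, then \<open>h (x y) = x f = x = h e\<close>,
  so \<open>x y = e\<close> by injectivity. This turns a statement about modules into an equation in
  the ring.\<close>

lemma (in ring) principal_left_module_isomorphicD:
  assumes "ring_idempotent R e" "ring_idempotent R f"
    and "left_module_isomorphic R (principal_left_module R e) (principal_left_module R f)"
  shows "\<exists>x\<in>carrier R. \<exists>y\<in>carrier R. e \<otimes> x \<otimes> f \<otimes> y \<otimes> e = e"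
proof -
  have ef: "e \<in> carrier R" "e \<otimes> e = e" "f \<in> carrier R" "f \<otimes> f = f"
    using assms by (auto simp: ring_idempotent_def)
  obtain h where h: "h \<in> left_module_hom R (principal_left_module R e) (principal_left_module R f)"
    "bij_betw h (carrier (principal_left_module R e)) (carrier (principal_left_module R f))"
    using assms by (auto simp: left_module_isomorphic_def)
  have car: "carrier (principal_left_module R a) = {b \<otimes> a |b. b \<in> carrier R}" for a
    by (simp add: principal_left_module_def)
  have eRe: "e \<in> carrier (principal_left_module R e)"
    using ef unfolding car by (intro CollectI exI[of _ e]) simp
  have fRf: "f \<in> carrier (principal_left_module R f)"
    using ef unfolding car by (intro CollectI exI[of _ f]) simp
  have hsm: "h (a \<otimes> z) = a \<otimes> h z" if "a \<in> carrier R" "z \<in> carrier (principal_left_module R e)" for a z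
    using left_module_homD(3)[OF h(1) that] by (simp add: principal_left_module_def)
  have hin: "h z \<in> carrier (principal_left_module R f)" if "z \<in> carrier (principal_left_module R e)" for z
    using left_module_homD(1)[OF h(1) that] .
  obtain y where y: "y \<in> carrier (principal_left_module R e)" "h y = f"
    using h(2) fRf by (metis bij_betw_imp_surj_on imageE)
  define x where "x = h e"
  have x: "x \<in> carrier R" "x \<otimes> f = x" using hin[OF eRe] ef by (auto simp: x_def car m_assoc)
  have yc: "y \<in> carrier R" "y \<otimes> e = y" using y ef by (auto simp: car m_assoc)
  have ex: "e \<otimes> x = x" using hsm[of e e] ef eRe by (simp add: x_def)
  have xy: "x \<otimes> y \<in> carrier (principal_left_module R e)"
    using x yc ef unfolding car by (intro CollectI exI[of _ "x \<otimes> y"]) (simp add: m_assoc)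
  have "h (x \<otimes> y) = h e" using hsm[of x y] x y by (simp add: x_def)
  then have "x \<otimes> y = e"
    using h(2) xy eRe by (metis bij_betw_imp_inj_on inj_onD)
  then have "e \<otimes> x \<otimes> f \<otimes> y \<otimes> e = e"
    using ef x yc ex by (simp add: m_assoc)
  then show ?thesis using x yc by blast
qed

text \<open>The interface between module theory and the two concrete algebras: only equations and
  memberships in the ring, which can be checked on basis elements and carried along an isomorphism.
  The sets \<open>I k\<close> imitate the powers of a nilpotent ideal. \<open>nonisomorphic\<close>
  excludes exactly the equation that an isomorphism between two of the principal modules would
  produce.\<close>

locale primitive_idempotent_system = R?: ring R for R (structure) +
  fixes I :: "nat \<Rightarrow> 'a set" and N :: nat and es :: "'a list"
  assumes I_0: "I 0 = carrier R" and I_sub: "I k \<subseteq> carrier R" and I_N: "I N = {\<zero>}"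
    and zero_I: "\<zero> \<in> I k"
    and add_I: "a \<in> I k \<Longrightarrow> b \<in> I k \<Longrightarrow> a \<oplus> b \<in> I k"
    and mult_I: "a \<in> I k \<Longrightarrow> b \<in> I 1 \<Longrightarrow> a \<otimes> b \<in> I (Suc k)"
    and idem: "e \<in> set es \<Longrightarrow> ring_idempotent R e"
    and nonzero: "e \<in> set es \<Longrightarrow> e \<noteq> \<zero>"
    and corner_idem: "\<lbrakk>e \<in> set es; ring_idempotent R f; e \<otimes> f \<otimes> e = f\<rbrakk> \<Longrightarrow> f = \<zero> \<or> f = e"
    and nonisomorphic: "\<lbrakk>i < length es; j < length es; x \<in> carrier R; y \<in> carrier R;
      es ! i \<otimes> x \<otimes> es ! j \<otimes> y \<otimes> es ! i = es ! i\<rbrakk> \<Longrightarrow> i = j"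
    and generate: "\<lbrakk>a \<in> carrier R; a \<notin> I 1\<rbrakk> \<Longrightarrow>
      \<exists>e\<in>set es. \<exists>x\<in>carrier R. \<exists>y\<in>carrier R. x \<otimes> a \<otimes> y = e"
begin

text \<open>Orthogonality gives \<open>e f = f = f e\<close> for a summand \<open>f\<close> of
  \<open>e\<close>, so \<open>f\<close> is an idempotent of the corner and
  \<open>corner_idem\<close> decides.\<close>

lemma primitive:
  assumes "e \<in> set es" shows "primitive_idempotent R e"
  unfolding primitive_idempotent_def
proof (intro conjI allI impI)
  fix f g
  assume fg: "ring_idempotent R f \<and> ring_idempotent R g \<and> f \<otimes> g = \<zero> \<and> g \<otimes> f = \<zero> \<and> e = f \<oplus> g"
  then have c: "f \<in> carrier R" "g \<in> carrier R" "f \<otimes> f = f" "g \<otimes> g = g"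
    by (auto simp: ring_idempotent_def)
  have "e \<otimes> f \<otimes> e = f"
    using fg c by (simp add: l_distr r_distr)
  then have "f = \<zero> \<or> f = e" using corner_idem assms fg by blast
  moreover have "g = \<zero>" if "f = e"
    using fg c that by (metis add.l_cancel_one')
  ultimately show "f = \<zero> \<or> g = \<zero>" by blast
qed (use assms idem nonzero in auto)

lemma represent_indecomposable_projectives:
  "represent_indecomposable_projectives TYPE('m) R es"
  unfolding represent_indecomposable_projectives_def
proof (intro conjI ballI allI impI)
  show "primitive_idempotent R e" if "e \<in> set es" for e
    using primitive[OF that] .
  fix i j assume ij: "i < length es" "j < length es"
    and iso: "left_module_isomorphic R (principal_left_module R (es ! i)) (principal_left_module R (es ! j))"
  then show "i = j"
    using nonisomorphic[OF ij] principal_left_module_isomorphicD[OF idem idem iso] by force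
next
  fix P :: "('a, 'm) module"
  assume P: "projective R P \<and> indecomposable R P"
  then have lm: "left_module R P" by (simp add: projective_def)
  then interpret P: left_module R P .
  obtain f x where f: "f \<in> left_module_hom R P (principal_left_module R \<one>)"
    and x: "x \<in> carrier P" "f x \<notin> I 1"
    using projective_not_into_nilpotent[of R P I N, OF ring_axioms _ _ I_0 I_N zero_I add_I mult_I] P
    unfolding indecomposable_def by blast
  note simps = principal_one_simps[OF ring_axioms]
  have fc: "f z \<in> carrier R" if "z \<in> carrier P" for z
    using left_module_homD(1)[OF f that] by (simp add: simps)
  obtain e a b where e: "e \<in> set es" and ab: "a \<in> carrier R" "b \<in> carrier R" "a \<otimes> f x \<otimes> b = e"
    using generate[OF fc x(2)] x by blast
  have ei: "e \<in> carrier R" "e \<otimes> e = e" using idem[OF e] by (auto simp: ring_idempotent_def)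
  \<comment> \<open>Right multiplication by \<open>b e\<close> is left linear and lands in
    \<open>R e\<close>; it sends \<open>f (a x) = a (f x)\<close> to
    \<open>a (f x) b e = e e = e\<close>.\<close>
  define h where "h z = f z \<otimes> (b \<otimes> e)" for z
  have "h \<in> left_module_hom R P (principal_left_module R e)"
    unfolding left_module_hom_def
  proof (intro CollectI conjI ballI)
    show "h \<in> carrier P \<rightarrow> carrier (principal_left_module R e)"
    proof
      fix z assume "z \<in> carrier P"
      then have "h z = (f z \<otimes> b) \<otimes> e" "f z \<otimes> b \<in> carrier R"
        using fc ab ei by (auto simp: h_def m_assoc)
      then show "h z \<in> carrier (principal_left_module R e)"
        by (auto simp: principal_left_module_def)
    qed
  qed (use left_module_homD[OF f] fc ab ei in \<open>simp_all add: h_def simps l_distr m_assoc\<close>)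
  moreover have "h (a \<odot>\<^bsub>P\<^esub> x) = e"
  proof -
    have "h (a \<odot>\<^bsub>P\<^esub> x) = (a \<otimes> f x \<otimes> b) \<otimes> e"
      using left_module_homD(3)[OF f ab(1) x(1)] fc x ab(1,2) ei
      by (simp add: h_def simps m_assoc)
    then show ?thesis using ab ei by simp
  qed
  moreover have "a \<odot>\<^bsub>P\<^esub> x \<in> carrier P" using ab x P.smult_closed by simp
  ultimately have "left_module_isomorphic R P (principal_left_module R e)"
    using indecomposable_isomorphic_principal[OF lm _ idem[OF e] nonzero[OF e]] P by blast
  then show "\<exists>i<length es. left_module_isomorphic R P (principal_left_module R (es ! i))"
    using e by (metis in_set_conv_nth)
qed

end

text \<open>Reduces an arbitrary isomorphic copy of the category algebra, in particular the monoid
  algebra of \<open>PO n\<close>, to the computation in \<open>EO n\<close>.\<close>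

lemma primitive_idempotent_system_iso:
  fixes R (structure) and S (structure)
  assumes "primitive_idempotent_system R I N es" "ring S" and h: "h \<in> ring_iso R S"
  shows "primitive_idempotent_system S (\<lambda>k. h ` I k) N (map h es)"
proof -
  interpret primitive_idempotent_system R I N es by fact
  interpret S: ring S by fact
  note hE = ring_iso_memE[OF h]
  \<comment> \<open>The image of zero is an additive idempotent, hence zero.\<close>
  have h0: "h \<zero> = \<zero>\<^bsub>S\<^esub>"
    using S.add.l_cancel_one[of "h \<zero>" "h \<zero>"] hE(1)[of \<zero>] hE(3)[of \<zero> \<zero>] by simp
  have inj: "h a = h b \<longleftrightarrow> a = b" if "a \<in> carrier R" "b \<in> carrier R" for a b
    using hE(5) that by (auto simp: bij_betw_def inj_on_def)
  have surj: "\<exists>a\<in>carrier R. s = h a" if "s \<in> carrier S" for s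
    using hE(5) that by (auto simp: bij_betw_def)
  show ?thesis
  proof
    fix f assume "f \<in> set (map h es)"
    then obtain e where e: "e \<in> set es" "f = h e" by auto
    note id = idem[OF e(1), unfolded ring_idempotent_def]
    show "ring_idempotent S f" using id e(2) hE(1,2)[of e] hE(2)[of e e] by (simp add: ring_idempotent_def)
    show "f \<noteq> \<zero>\<^bsub>S\<^esub>" using e(2) nonzero[OF e(1)] id h0 inj[of e \<zero>] by simp
    show "g = \<zero>\<^bsub>S\<^esub> \<or> g = f" if g: "ring_idempotent S g" "f \<otimes>\<^bsub>S\<^esub> g \<otimes>\<^bsub>S\<^esub> f = g" for g
    proof -
      obtain b where b: "b \<in> carrier R" "g = h b"
        using g surj by (auto simp: ring_idempotent_def)
      have "h (b \<otimes> b) = h b" "h (e \<otimes> b \<otimes> e) = h b"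
        using g b e id hE(1,2) by (auto simp: ring_idempotent_def)
      then have "ring_idempotent R b" "e \<otimes> b \<otimes> e = b"
        using inj b id by (auto simp: ring_idempotent_def)
      then show ?thesis using corner_idem[OF e(1)] b e h0 by auto
    qed
  next
    fix i j x y
    assume ij: "i < length (map h es)" "j < length (map h es)" and xy: "x \<in> carrier S" "y \<in> carrier S"
      and eq: "map h es ! i \<otimes>\<^bsub>S\<^esub> x \<otimes>\<^bsub>S\<^esub> map h es ! j \<otimes>\<^bsub>S\<^esub> y \<otimes>\<^bsub>S\<^esub> map h es ! i = map h es ! i"
    obtain a b where ab: "a \<in> carrier R" "x = h a" "b \<in> carrier R" "y = h b"
      using surj xy by metis
    have c: "es ! i \<in> carrier R" "es ! j \<in> carrier R"
      using idem ij by (auto simp: ring_idempotent_def)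
    have "h (es ! i \<otimes> a \<otimes> es ! j \<otimes> b \<otimes> es ! i) = h (es ! i)"
      using eq ij ab c hE(1,2) by simp
    then show "i = j"
      using nonisomorphic[of i j a b] ij ab c inj by simp
  next
    fix a assume a: "a \<in> carrier S" "a \<notin> h ` I 1"
    then obtain b where b: "b \<in> carrier R" "a = h b" "b \<notin> I 1" using surj by blast
    then obtain e x y where "e \<in> set es" "x \<in> carrier R" "y \<in> carrier R" "x \<otimes> b \<otimes> y = e"
      using generate by blast
    moreover from this have "h x \<otimes>\<^bsub>S\<^esub> a \<otimes>\<^bsub>S\<^esub> h y = h e" "h x \<in> carrier S" "h y \<in> carrier S"
      using b hE(1) hE(2)[of x b] hE(2)[of "x \<otimes> b" y] by simp_all
    ultimately show "\<exists>e\<in>set (map h es). \<exists>x\<in>carrier S. \<exists>y\<in>carrier S. x \<otimes>\<^bsub>S\<^esub> a \<otimes>\<^bsub>S\<^esub> y = e" by auto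
  next
    show "h ` I 0 = carrier S" using I_0 hE(5) by (simp add: bij_betw_def)
    show "h ` I k \<subseteq> carrier S" for k using I_sub hE(1) by blast
    show "h ` I N = {\<zero>\<^bsub>S\<^esub>}" using I_N h0 by simp
    show "\<zero>\<^bsub>S\<^esub> \<in> h ` I k" for k using zero_I h0 by (metis imageI)
    fix a b k
    show "a \<oplus>\<^bsub>S\<^esub> b \<in> h ` I k" if mem: "a \<in> h ` I k" "b \<in> h ` I k"
    proof -
      obtain a' b' where ab: "a' \<in> I k" "a = h a'" "b' \<in> I k" "b = h b'" using mem by blast
      then have "a \<oplus>\<^bsub>S\<^esub> b = h (a' \<oplus> b')" using hE(3)[of a' b'] subsetD[OF I_sub] by simp
      then show ?thesis using add_I ab by blast
    qed
    show "a \<otimes>\<^bsub>S\<^esub> b \<in> h ` I (Suc k)" if mem: "a \<in> h ` I k" "b \<in> h ` I 1"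
    proof -
      obtain a' b' where ab: "a' \<in> I k" "a = h a'" "b' \<in> I 1" "b = h b'" using mem by blast
      then have "a \<otimes>\<^bsub>S\<^esub> b = h (a' \<otimes> b')" using hE(2)[of a' b'] subsetD[OF I_sub] by simp
      then show ?thesis using mult_I ab by blast
    qed
  qed
qed

section \<open>Category algebras\<close>

text \<open>The indicator functions of the points of \<open>X\<close> form a basis. The record
  \<open>V\<close> is arbitrary so that the result serves both the full algebras and their corners,
  which differ only in the carrier.\<close>

lemma
  fixes V :: "('k::field, 'b \<Rightarrow> 'k, 'z) module_scheme"
  assumes car: "carrier V = {f. \<forall>m. m \<notin> X \<longrightarrow> f m = 0}" and X: "finite X"
    and zero: "\<zero>\<^bsub>V\<^esub> = (\<lambda>m. 0)" and add: "\<And>f g. f \<oplus>\<^bsub>V\<^esub> g = (\<lambda>m. f m + g m)"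
    and smult: "\<And>c f. c \<odot>\<^bsub>V\<^esub> f = (\<lambda>m. c * f m)"
  shows vectorspace_fun: "vectorspace class_ring V"
    and fin_dim_fun: "vectorspace.fin_dim class_ring V"
    and dim_fun: "vectorspace.dim class_ring V = card X"
proof -
  have ag: "abelian_group V"
  proof (rule abelian_groupI)
    show "\<exists>g\<in>carrier V. g \<oplus>\<^bsub>V\<^esub> f = \<zero>\<^bsub>V\<^esub>" if "f \<in> carrier V" for f
      using that by (intro bexI[of _ "\<lambda>m. - f m"]) (auto simp: car zero add)
  qed (auto simp: car zero add)
  show vs: "vectorspace class_ring V"
  proof (intro vectorspace.intro moduleI)
    show "field (class_ring :: 'k ring)" "cring (class_ring :: 'k ring)"
      by unfold_locales
  qed (use ag in \<open>auto simp: car add smult algebra_simps\<close>)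
  then interpret V: vectorspace class_ring V .
  have inj: "inj_on (basis_element :: 'b \<Rightarrow> 'b \<Rightarrow> 'k) X"
    by (rule inj_onI) (metis basis_element_def zero_neq_one)
  have fs: "finsum V F A = (\<lambda>m. \<Sum>x\<in>A. F x m)" if "finite A" "F \<in> A \<rightarrow> carrier V"
    for F :: "('b \<Rightarrow> 'k) \<Rightarrow> 'b \<Rightarrow> 'k" and A
    using that by (induction A) (auto simp: zero add V.M.finsum_insert Pi_iff)
  let ?B = "(basis_element :: 'b \<Rightarrow> 'b \<Rightarrow> 'k) ` X"
  have BV: "?B \<subseteq> carrier V" by (auto simp: car basis_element_def)
  have lc: "V.lincomb a ?B = (\<lambda>m. if m \<in> X then a (basis_element m) else 0)" for a
  proof -
    have "V.lincomb a ?B = (\<lambda>m. \<Sum>v\<in>?B. a v * v m)"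
      unfolding V.lincomb_def using BV X by (subst fs) (auto simp: smult car)
    also have "\<dots> = (\<lambda>m. \<Sum>x\<in>X. a (basis_element x) * basis_element x m)"
      by (simp add: sum.reindex[OF inj])
    also have "\<dots> = (\<lambda>m. \<Sum>x\<in>X. if x = m then a (basis_element x) else 0)"
      by (auto simp: basis_element_def fun_eq_iff intro!: sum.cong)
    finally show ?thesis using X by simp
  qed
  have "V.basis ?B"
    unfolding V.basis_criterion[OF finite_imageI[OF X] BV]
  proof (intro allI impI)
    fix v assume v: "v \<in> carrier V"
    \<comment> \<open>The coefficient of an indicator function is the value of \<open>v\<close> at
      its point. Restricting to \<open>?B\<close> makes the coefficient function extensional, as
      uniqueness demands.\<close>
    let ?a = "\<lambda>w\<in>?B. v (inv_into X basis_element w)"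
    show "\<exists>!a. a \<in> ?B \<rightarrow>\<^sub>E carrier class_ring \<and> V.lincomb a ?B = v"
    proof (rule ex1I[of _ ?a])
      show "?a \<in> ?B \<rightarrow>\<^sub>E carrier class_ring \<and> V.lincomb ?a ?B = v"
        using v inj by (auto simp: lc car)
      fix a assume "a \<in> ?B \<rightarrow>\<^sub>E carrier class_ring \<and> V.lincomb a ?B = v"
      then show "a = ?a"
        using inj by (intro ext) (auto simp: lc PiE_iff extensional_def)
    qed
  qed
  moreover from this have "V.dim = card ?B" using X by (intro V.dim_basis) auto
  ultimately show "V.fin_dim" "V.dim = card X"
    using X BV card_image[OF inj] by (auto simp: V.fin_dim_def V.basis_def)
qed

text \<open>The record \<open>category\<close> carries no laws. Stating them here allows
  \<open>EO n\<close> and the one-object category of the monoid \<open>PO n\<close> to share all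
  computations.\<close>

locale finite_category =
  fixes C :: "('o, 'b, 'c) category_scheme"
  assumes finite_Ob: "finite (Ob C)" and finite_Mor: "finite (Mor C)"
    and src_Ob: "m \<in> Mor C \<Longrightarrow> src C m \<in> Ob C" and tgt_Ob: "m \<in> Mor C \<Longrightarrow> tgt C m \<in> Ob C"
    and idt_Mor: "S \<in> Ob C \<Longrightarrow> idt C S \<in> Mor C"
    and src_idt: "S \<in> Ob C \<Longrightarrow> src C (idt C S) = S"
    and tgt_idt: "S \<in> Ob C \<Longrightarrow> tgt C (idt C S) = S"
    and cmp_Mor: "\<lbrakk>p \<in> Mor C; q \<in> Mor C; src C p = tgt C q\<rbrakk> \<Longrightarrow> cmp C p q \<in> Mor C"
    and src_cmp: "\<lbrakk>p \<in> Mor C; q \<in> Mor C; src C p = tgt C q\<rbrakk> \<Longrightarrow> src C (cmp C p q) = src C q"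
    and tgt_cmp: "\<lbrakk>p \<in> Mor C; q \<in> Mor C; src C p = tgt C q\<rbrakk> \<Longrightarrow> tgt C (cmp C p q) = tgt C p"
    and cmp_assoc: "\<lbrakk>p \<in> Mor C; q \<in> Mor C; r \<in> Mor C; src C p = tgt C q; src C q = tgt C r\<rbrakk> \<Longrightarrow>
      cmp C (cmp C p q) r = cmp C p (cmp C q r)"
    and cmp_idt_left: "p \<in> Mor C \<Longrightarrow> cmp C (idt C (tgt C p)) p = p"
    and cmp_idt_right: "p \<in> Mor C \<Longrightarrow> cmp C p (idt C (src C p)) = p"
begin

text \<open>An iterated sum over all morphisms, with the composability condition moved into the
  summand, can be swapped and distributed freely.\<close>

lemma category_algebra_mult:
  "(f \<otimes>\<^bsub>category_algebra C\<^esub> g) m =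
    (\<Sum>p\<in>Mor C. \<Sum>q\<in>Mor C. if src C p = tgt C q \<and> cmp C p q = m then f p * g q else 0)"
proof -
  have "(f \<otimes>\<^bsub>category_algebra C\<^esub> g) m =
    (\<Sum>x\<in>{x \<in> Mor C \<times> Mor C. src C (fst x) = tgt C (snd x) \<and> cmp C (fst x) (snd x) = m}. f (fst x) * g (snd x))"
    unfolding category_algebra_def by (auto intro!: sum.cong)
  also have "\<dots> = (\<Sum>x\<in>Mor C \<times> Mor C.
    if src C (fst x) = tgt C (snd x) \<and> cmp C (fst x) (snd x) = m then f (fst x) * g (snd x) else 0)"
    by (intro sum.inter_filter) (simp add: finite_Mor)
  finally show ?thesis by (simp add: sum.cartesian_product split_def)
qed

text \<open>The product spreads \<open>f p g q\<close> along composition, so pairing it with a test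
  function \<open>h\<close> evaluates \<open>h\<close> at composites. Different choices of
  \<open>h\<close> yield associativity, the corner formula and multiplicativity of
  \<open>restriction_sum\<close>.\<close>

lemma sum_category_algebra_mult:
  "(\<Sum>m\<in>Mor C. (f \<otimes>\<^bsub>category_algebra C\<^esub> g) m * h m) =
    (\<Sum>p\<in>Mor C. \<Sum>q\<in>Mor C. if src C p = tgt C q then f p * g q * h (cmp C p q) else 0)"
proof -
  have "(\<Sum>m\<in>Mor C. (f \<otimes>\<^bsub>category_algebra C\<^esub> g) m * h m) = (\<Sum>m\<in>Mor C. \<Sum>p\<in>Mor C. \<Sum>q\<in>Mor C.
      if src C p = tgt C q \<and> cmp C p q = m then f p * g q * h m else 0)"
    unfolding category_algebra_mult sum_distrib_right by (intro sum.cong refl) simp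
  also have "\<dots> = (\<Sum>p\<in>Mor C. \<Sum>q\<in>Mor C. \<Sum>m\<in>Mor C.
      if src C p = tgt C q \<and> cmp C p q = m then f p * g q * h m else 0)"
    by (subst sum.swap) (intro sum.cong refl sum.swap)
  also have "\<dots> = (\<Sum>p\<in>Mor C. \<Sum>q\<in>Mor C. if src C p = tgt C q then f p * g q * h (cmp C p q) else 0)"
  proof (intro sum.cong refl)
    fix p q assume "p \<in> Mor C" "q \<in> Mor C"
    then show "(\<Sum>m\<in>Mor C. if src C p = tgt C q \<and> cmp C p q = m then f p * g q * h m else 0) =
      (if src C p = tgt C q then f p * g q * h (cmp C p q) else 0)"
      using finite_Mor cmp_Mor by (cases "src C p = tgt C q") auto
  qed
  finally show ?thesis .
qed

lemma category_algebra_mult_left: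
  "(f \<otimes>\<^bsub>category_algebra C\<^esub> g) m =
    (\<Sum>p\<in>Mor C. f p * (\<Sum>q\<in>Mor C. if src C p = tgt C q \<and> cmp C p q = m then g q else 0))"
  unfolding category_algebra_mult sum_distrib_left by (intro sum.cong refl) simp

lemma category_algebra_mult_right:
  "(f \<otimes>\<^bsub>category_algebra C\<^esub> g) m =
    (\<Sum>q\<in>Mor C. g q * (\<Sum>p\<in>Mor C. if src C p = tgt C q \<and> cmp C p q = m then f p else 0))"
  unfolding category_algebra_mult sum_distrib_left
  by (subst sum.swap) (intro sum.cong refl, simp)

text \<open>Both bracketings are the sum over composable triples; \<open>src_cmp\<close> and
  \<open>tgt_cmp\<close> make the two composability conditions agree.\<close>

lemma category_algebra_assoc:
  "(f \<otimes>\<^bsub>category_algebra C\<^esub> g) \<otimes>\<^bsub>category_algebra C\<^esub> h =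
    f \<otimes>\<^bsub>category_algebra C\<^esub> (g \<otimes>\<^bsub>category_algebra C\<^esub> h)"
proof
  fix m
  have "((f \<otimes>\<^bsub>category_algebra C\<^esub> g) \<otimes>\<^bsub>category_algebra C\<^esub> h) m =
    (\<Sum>p\<in>Mor C. \<Sum>q\<in>Mor C. \<Sum>r\<in>Mor C.
      if src C p = tgt C q \<and> src C q = tgt C r \<and> cmp C p (cmp C q r) = m then f p * g q * h r else 0)"
    unfolding category_algebra_mult_left[of "f \<otimes>\<^bsub>category_algebra C\<^esub> g"] sum_category_algebra_mult
    by (intro sum.cong refl) (auto simp: sum_distrib_left src_cmp cmp_assoc intro!: sum.cong)
  also have "\<dots> = (f \<otimes>\<^bsub>category_algebra C\<^esub> (g \<otimes>\<^bsub>category_algebra C\<^esub> h)) m"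
  proof -
    have "(\<Sum>q\<in>Mor C. if src C p = tgt C q \<and> cmp C p q = m
        then (g \<otimes>\<^bsub>category_algebra C\<^esub> h) q else 0) = (\<Sum>q\<in>Mor C. \<Sum>r\<in>Mor C.
        if src C p = tgt C q \<and> src C q = tgt C r \<and> cmp C p (cmp C q r) = m then g q * h r else 0)"
      if p: "p \<in> Mor C" for p
    proof -
      have "(\<Sum>q\<in>Mor C. if src C p = tgt C q \<and> cmp C p q = m
          then (g \<otimes>\<^bsub>category_algebra C\<^esub> h) q else 0) = (\<Sum>q\<in>Mor C. (g \<otimes>\<^bsub>category_algebra C\<^esub> h) q *
          (if src C p = tgt C q \<and> cmp C p q = m then 1 else 0))"
        by (intro sum.cong refl) simp
      also have "\<dots> = (\<Sum>q\<in>Mor C. \<Sum>r\<in>Mor C.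
          if src C p = tgt C q \<and> src C q = tgt C r \<and> cmp C p (cmp C q r) = m then g q * h r else 0)"
        unfolding sum_category_algebra_mult by (intro sum.cong refl) (auto simp: tgt_cmp)
      finally show ?thesis .
    qed
    then show ?thesis
      unfolding category_algebra_mult_left[of f]
      by (intro sum.cong refl) (auto simp: sum_distrib_left mult.assoc intro!: sum.cong)
  qed
  finally show "((f \<otimes>\<^bsub>category_algebra C\<^esub> g) \<otimes>\<^bsub>category_algebra C\<^esub> h) m =
    (f \<otimes>\<^bsub>category_algebra C\<^esub> (g \<otimes>\<^bsub>category_algebra C\<^esub> h)) m" .
qed

lemma sum_one_category_algebra:
  "(\<Sum>p\<in>Mor C. \<one>\<^bsub>category_algebra C\<^esub> p * h p) = (\<Sum>S\<in>Ob C. h (idt C S))"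
proof -
  have "(\<Sum>p\<in>Mor C. \<one>\<^bsub>category_algebra C\<^esub> p * h p) =
    (\<Sum>S\<in>Ob C. \<Sum>p\<in>Mor C. if p = idt C S then h p else 0)"
    unfolding category_algebra_def
    by (subst sum.swap) (auto simp: sum_distrib_right basis_element_def intro!: sum.cong)
  also have "\<dots> = (\<Sum>S\<in>Ob C. h (idt C S))"
    using finite_Mor idt_Mor by (intro sum.cong refl) simp
  finally show ?thesis .
qed

lemma category_algebra_one_mult:
  assumes "f \<in> carrier (category_algebra C)"
  shows "\<one>\<^bsub>category_algebra C\<^esub> \<otimes>\<^bsub>category_algebra C\<^esub> f = f"
proof
  fix m
  have "(\<one>\<^bsub>category_algebra C\<^esub> \<otimes>\<^bsub>category_algebra C\<^esub> f) m =
    (\<Sum>q\<in>Mor C. \<Sum>S\<in>Ob C. if src C (idt C S) = tgt C q \<and> cmp C (idt C S) q = m then f q else 0)"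
    unfolding category_algebra_mult_left sum_one_category_algebra by (rule sum.swap)
  \<comment> \<open>Among the identities only the one at \<open>tgt C q\<close> composes with
    \<open>q\<close>, and it returns \<open>q\<close>.\<close>
  also have "\<dots> = (\<Sum>q\<in>Mor C. \<Sum>S\<in>Ob C. if S = tgt C q then (if q = m then f q else 0) else 0)"
    by (intro sum.cong refl) (auto simp: src_idt cmp_idt_left)
  also have "\<dots> = (\<Sum>q\<in>Mor C. if q = m then f q else 0)"
    using finite_Ob tgt_Ob by (intro sum.cong refl) simp
  also have "\<dots> = f m"
    using assms finite_Mor by (auto simp: category_algebra_def)
  finally show "(\<one>\<^bsub>category_algebra C\<^esub> \<otimes>\<^bsub>category_algebra C\<^esub> f) m = f m" .
qed

lemma category_algebra_mult_one:
  assumes "f \<in> carrier (category_algebra C)"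
  shows "f \<otimes>\<^bsub>category_algebra C\<^esub> \<one>\<^bsub>category_algebra C\<^esub> = f"
proof
  fix m
  have "(f \<otimes>\<^bsub>category_algebra C\<^esub> \<one>\<^bsub>category_algebra C\<^esub>) m =
    (\<Sum>p\<in>Mor C. \<Sum>S\<in>Ob C. if src C p = tgt C (idt C S) \<and> cmp C p (idt C S) = m then f p else 0)"
    unfolding category_algebra_mult_right sum_one_category_algebra by (rule sum.swap)
  also have "\<dots> = (\<Sum>p\<in>Mor C. \<Sum>S\<in>Ob C. if src C p = S then (if p = m then f p else 0) else 0)"
    by (intro sum.cong refl) (auto simp: tgt_idt cmp_idt_right)
  also have "\<dots> = (\<Sum>p\<in>Mor C. if p = m then f p else 0)"
    using finite_Ob src_Ob by (intro sum.cong refl) simp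
  also have "\<dots> = f m"
    using assms finite_Mor by (auto simp: category_algebra_def)
  finally show "(f \<otimes>\<^bsub>category_algebra C\<^esub> \<one>\<^bsub>category_algebra C\<^esub>) m = f m" .
qed

lemma category_algebra_simps:
  "carrier (category_algebra C) = {f. \<forall>m. m \<notin> Mor C \<longrightarrow> f m = 0}"
  "\<zero>\<^bsub>category_algebra C\<^esub> = (\<lambda>m. 0)"
  "f \<oplus>\<^bsub>category_algebra C\<^esub> g = (\<lambda>m. f m + g m)"
  "c \<odot>\<^bsub>category_algebra C\<^esub> f = (\<lambda>m. c * f m)"
  by (simp_all add: category_algebra_def)

lemma fin_dim_algebra_category_algebra:
  "fin_dim_algebra class_ring (category_algebra C :: ('k::field, 'b \<Rightarrow> 'k) module)"
proof -
  let ?A = "category_algebra C :: ('k, 'b \<Rightarrow> 'k) module"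
  note sp = category_algebra_simps
  note fn = category_algebra_simps(1) finite_Mor category_algebra_simps(2-4)
  have vs: "vectorspace class_ring ?A" by (rule vectorspace_fun[OF fn])
  then interpret V: vectorspace class_ring ?A .
  have mc: "f \<otimes>\<^bsub>?A\<^esub> g \<in> carrier ?A" for f g
  proof -
    have "(f \<otimes>\<^bsub>?A\<^esub> g) m = 0" if "m \<notin> Mor C" for m
      unfolding category_algebra_mult using that cmp_Mor by (intro sum.neutral ballI) auto
    then show ?thesis by (simp add: sp)
  qed
  have one: "\<one>\<^bsub>?A\<^esub> \<in> carrier ?A"
    using idt_Mor by (auto simp: category_algebra_def basis_element_def intro!: sum.neutral)
  have "ring ?A"
  proof (rule ringI)
    show "abelian_group ?A" ..
    show "Group.monoid ?A"
      by (rule monoidI) (simp_all add: mc one category_algebra_assoc category_algebra_one_mult category_algebra_mult_one)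
    show "(x \<oplus>\<^bsub>?A\<^esub> y) \<otimes>\<^bsub>?A\<^esub> z = x \<otimes>\<^bsub>?A\<^esub> z \<oplus>\<^bsub>?A\<^esub> y \<otimes>\<^bsub>?A\<^esub> z"
      and "z \<otimes>\<^bsub>?A\<^esub> (x \<oplus>\<^bsub>?A\<^esub> y) = z \<otimes>\<^bsub>?A\<^esub> x \<oplus>\<^bsub>?A\<^esub> z \<otimes>\<^bsub>?A\<^esub> y" for x y z
      unfolding sp(3) fun_eq_iff
      by (simp_all only: category_algebra_mult_left[of _ z] category_algebra_mult_right[of z]
          sum.distrib distrib_right simp_thms)
  qed
  moreover have "vectorspace.fin_dim class_ring ?A" by (rule fin_dim_fun[OF fn])
  moreover have "(c \<odot>\<^bsub>?A\<^esub> x) \<otimes>\<^bsub>?A\<^esub> y = c \<odot>\<^bsub>?A\<^esub> (x \<otimes>\<^bsub>?A\<^esub> y)"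
    and "x \<otimes>\<^bsub>?A\<^esub> (c \<odot>\<^bsub>?A\<^esub> y) = c \<odot>\<^bsub>?A\<^esub> (x \<otimes>\<^bsub>?A\<^esub> y)" for c x y
    by (simp_all add: sp(4) fun_eq_iff category_algebra_mult sum_distrib_left if_distrib mult_ac cong: if_cong)
  ultimately show ?thesis
    using vs by (simp add: fin_dim_algebra_def fin_dim_algebra_axioms_def)
qed

end

section \<open>Order-preserving partial maps\<close>

lemma order_preserving_comp:
  assumes "order_preserving p" "order_preserving q"
  shows "order_preserving (p \<circ>\<^sub>m q)"
  unfolding order_preserving_def
proof (intro ballI impI)
  fix x y assume "x \<in> dom (p \<circ>\<^sub>m q)" "y \<in> dom (p \<circ>\<^sub>m q)" and xy: "x \<le> y"
  then obtain a b c d where *: "q x = Some a" "p a = Some c" "q y = Some b" "p b = Some d"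
    by (auto simp: map_comp_Some_iff)
  then have "a \<le> b" using assms(2) xy unfolding order_preserving_def
    by (metis domI option.sel)
  then have "c \<le> d" using assms(1) * unfolding order_preserving_def
    by (metis domI option.sel)
  then show "the ((p \<circ>\<^sub>m q) x) \<le> the ((p \<circ>\<^sub>m q) y)" using * by simp
qed

lemma order_preserving_map_le:
  assumes "order_preserving f" "g \<subseteq>\<^sub>m f"
  shows "order_preserving g"
  using assms map_le_implies_dom_le[OF assms(2)]
  unfolding order_preserving_def map_le_def by (metis subsetD)

lemma order_preserving_id: "order_preserving (Some |` A)"
  by (auto simp: order_preserving_def restrict_map_def split: if_splits)

lemma ran_eq_image_dom: "ran f = (\<lambda>x. the (f x)) ` dom f"
  by (force simp: ran_def dom_def)

lemma dom_comp:
  assumes "dom p = ran q" shows "dom (p \<circ>\<^sub>m q) = dom q"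
proof -
  have "p a \<noteq> None" if "q x = Some a" for x a
    using assms that by (metis domIff ranI)
  then show ?thesis by (auto simp: map_comp_def dom_def split: option.splits)
qed

lemma ran_comp:
  assumes "dom p = ran q" shows "ran (p \<circ>\<^sub>m q) = ran p"
proof -
  have "\<exists>x. q x = Some a" if "p a = Some b" for a b
    using assms that by (auto simp: ran_def dom_def)
  then show ?thesis unfolding ran_def map_comp_Some_iff by blast
qed

lemma map_comp_assoc: "(p \<circ>\<^sub>m q) \<circ>\<^sub>m r = p \<circ>\<^sub>m (q \<circ>\<^sub>m r)"
  by (auto simp: map_comp_def fun_eq_iff split: option.splits)

lemma id_comp: "Some |` ran p \<circ>\<^sub>m p = p"
  by (auto simp: map_comp_def restrict_map_def ran_def fun_eq_iff split: option.splits)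

lemma comp_id: "p \<circ>\<^sub>m Some |` dom p = p"
proof
  fix x
  show "(p \<circ>\<^sub>m Some |` dom p) x = p x"
    by (cases "p x") (auto simp: map_comp_def restrict_map_def)
qed

lemma dom_id: "dom (Some |` A) = A"
  by (auto simp: restrict_map_def dom_def)

lemma ran_id: "ran (Some |` A) = A"
  by (auto simp: restrict_map_def ran_def split: if_splits)

lemma card_ran_le: "finite (dom f) \<Longrightarrow> card (ran f) \<le> card (dom f)"
  by (simp add: ran_eq_image_dom card_image_le)

text \<open>Along the increasing list of the domain, both maps produce a sorted list without
  repetitions and with the same entries, and such a list is unique. Equal cardinality of domain and
  range is what rules out repetitions. This rigidity makes a morphism of degree 0 depend only on its
  domain and range.\<close>

lemma order_preserving_bijection_unique:
  assumes "order_preserving f" "order_preserving g" "finite (dom f)"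
    and "dom f = dom g" "ran f = ran g" "card (ran f) = card (dom f)"
  shows "f = g"
proof -
  define xs where "xs = sorted_list_of_set (dom f)"
  have xs: "sorted xs" "distinct xs" "set xs = dom f" using assms(3) by (auto simp: xs_def)
  have *: "sorted (map (\<lambda>x. the (h x)) xs) \<and> distinct (map (\<lambda>x. the (h x)) xs)
      \<and> set (map (\<lambda>x. the (h x)) xs) = ran f"
    if h: "order_preserving h" "dom h = dom f" "ran h = ran f" for h
  proof -
    have set: "set (map (\<lambda>x. the (h x)) xs) = ran f"
      using h xs by (simp add: ran_eq_image_dom)
    moreover have "sorted (map (\<lambda>x. the (h x)) xs)"
      unfolding sorted_map using h(1,2) xs(3)
      by (auto simp: order_preserving_def intro: sorted_wrt_mono_rel[OF _ xs(1)])
    moreover have "card (ran f) = length xs"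
      using xs distinct_card[OF xs(2)] assms(6) by simp
    then have "distinct (map (\<lambda>x. the (h x)) xs)"
      by (intro card_distinct) (simp only: set length_map)
    ultimately show ?thesis by blast
  qed
  have "map (\<lambda>x. the (f x)) xs = map (\<lambda>x. the (g x)) xs"
    using *[of f] *[of g] assms by (intro sorted_distinct_set_unique) auto
  then have "the (f x) = the (g x)" if "x \<in> dom f" for x
    using that xs(3) by (auto simp: map_eq_conv)
  then show ?thesis
    using assms(4) by (intro ext) (metis domIff domD option.sel)
qed

text \<open>Run back through the increasing enumeration of \<open>A\<close> and forward through that
  of \<open>B\<close>.\<close>

lemma order_preserving_bijection_exists:
  fixes A B :: "nat set"
  assumes "finite A" "finite B" "card A = card B"
  obtains f where "dom f = A" "ran f = B" "order_preserving f"
proof -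
  obtain g where g: "bij_betw g {..<card A} A" "strict_mono_on {..<card A} g"
    using ex_bij_betw_strict_mono_card[OF assms(1)] .
  obtain h where h: "bij_betw h {..<card B} B" "strict_mono_on {..<card B} h"
    using ex_bij_betw_strict_mono_card[OF assms(2)] .
  define k where "k = (\<lambda>x. h (inv_into {..<card A} g x))"
  have inv: "bij_betw (inv_into {..<card A} g) A {..<card A}" using g(1) by (rule bij_betw_inv_into)
  then have k: "bij_betw k A B"
    using h(1) assms(3) bij_betw_trans unfolding k_def by (fastforce simp: comp_def)
  define f where "f = (\<lambda>x. if x \<in> A then Some (k x) else None)"
  have fd: "dom f = A" by (auto simp: f_def dom_def)
  show thesis
  proof
    show "dom f = A" by fact
    have "ran f = k ` A"
      unfolding ran_eq_image_dom fd by (auto simp: f_def)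
    then show "ran f = B" using k by (simp add: bij_betw_def)
    show "order_preserving f"
      unfolding order_preserving_def fd
    proof (intro ballI impI)
      fix x y assume xy: "x \<in> A" "y \<in> A" "x \<le> y"
      let ?i = "inv_into {..<card A} g"
      have i: "?i x \<in> {..<card A}" "?i y \<in> {..<card A}"
        using inv xy by (auto simp: bij_betw_def)
      have gi: "g (?i x) = x" "g (?i y) = y"
        using g(1) xy by (auto simp: bij_betw_def f_inv_into_f)
      have "?i x \<le> ?i y"
      proof (rule ccontr)
        assume "\<not> ?i x \<le> ?i y"
        then have "g (?i y) < g (?i x)" using g(2) i by (auto simp: strict_mono_on_def)
        then show False using gi xy by simp
      qed
      then have "k x \<le> k y"
        using h(2) i assms(3) unfolding k_def by (metis strict_mono_on_leD)
      then show "the (f x) \<le> the (f y)" using xy by (simp add: f_def)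
    qed
  qed
qed

section \<open>Counting order-preserving surjections between initial intervals\<close>

definition order_surjections :: "nat \<Rightarrow> nat \<Rightarrow> (nat \<rightharpoonup> nat) set" where
  "order_surjections b a = {f. dom f = {1..b} \<and> ran f = {1..a} \<and> order_preserving f}"

lemma finite_order_surjections: "finite (order_surjections b a)"
  by (rule finite_subset[OF _ finite_set_of_finite_maps[of "{1..b}" "{1..a}"]])
    (auto simp: order_surjections_def)

text \<open>The empty map is the origin of the convention that the binomial coefficient of -1 over
  -1 is 1. Likewise \<open>order_surjections_Suc_0\<close> accounts for the value 0 of the other
  coefficients with lower index -1.\<close>

lemma card_order_surjections_0_0: "card (order_surjections 0 0) = 1"
proof -
  have "order_surjections 0 0 = {Map.empty}"
    by (auto simp: order_surjections_def order_preserving_def)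
  then show ?thesis by simp
qed

lemma order_surjections_0_Suc: "order_surjections 0 (Suc a) = {}"
  by (auto simp: order_surjections_def)

lemma order_surjections_Suc_0: "order_surjections (Suc b) 0 = {}"
proof -
  have False if "dom f = {1..Suc b}" "ran f = {1..0}" for f :: "nat \<rightharpoonup> nat"
  proof -
    have "1 \<in> dom f" using that by simp
    then show False using that(2) by (auto simp: dom_def ran_def)
  qed
  then show ?thesis unfolding order_surjections_def by blast
qed

text \<open>Some point attains the maximum \<open>Suc a\<close>, and by monotonicity the last point
  is mapped at least as high.\<close>

lemma order_surjection_last:
  assumes "f \<in> order_surjections (Suc b) (Suc a)"
  shows "f (Suc b) = Some (Suc a)"
proof -
  have f: "dom f = {1..Suc b}" "ran f = {1..Suc a}" "order_preserving f"
    using assms by (auto simp: order_surjections_def)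
  have "Suc a \<in> ran f" using f by simp
  then obtain x where x: "f x = Some (Suc a)" by (auto simp: ran_def)
  then have xd: "x \<in> dom f" by auto
  have "Suc b \<in> dom f" using f by simp
  then obtain y where y: "f (Suc b) = Some y" by auto
  then have "y \<in> ran f" by (auto simp: ran_def)
  moreover have "Suc a \<le> y"
    using f(1,3) xd x y \<open>Suc b \<in> dom f\<close> unfolding order_preserving_def
    by (metis atLeastAtMost_iff option.sel)
  ultimately show ?thesis using y f(2) by simp
qed

text \<open>The value at the last point is forced, so the map is recovered from its restriction to
  \<open>{1..b}\<close>. The restriction still attains \<open>Suc a\<close> unless the last fibre
  was a singleton, whence the two ranges.\<close>

lemma order_surjections_Suc_Suc:
  "order_surjections (Suc b) (Suc a) =
    (\<lambda>f. f(Suc b \<mapsto> Suc a)) ` (order_surjections b (Suc a) \<union> order_surjections b a)"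
proof (intro equalityI subsetI)
  fix f assume fS: "f \<in> order_surjections (Suc b) (Suc a)"
  then have f: "dom f = {1..Suc b}" "ran f = {1..Suc a}" "order_preserving f"
    by (auto simp: order_surjections_def)
  have last: "f (Suc b) = Some (Suc a)" by (rule order_surjection_last[OF fS])
  define g where "g = f |` {1..b}"
  have fg: "f = g(Suc b \<mapsto> Suc a)"
  proof
    fix x
    have "f x = None" if "x \<notin> {1..Suc b}" using that f(1) by (metis domIff)
    then show "f x = (g(Suc b \<mapsto> Suc a)) x"
      using last by (cases "x = Suc b") (auto simp: g_def restrict_map_def)
  qed
  have gd: "dom g = {1..b}" using f(1) by (auto simp: g_def)
  have gnone: "g (Suc b) = None" using gd domIff[of "Suc b" g] by simp
  have gop: "order_preserving g"
    using f(3) by (rule order_preserving_map_le) (simp add: g_def map_le_def)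
  have "ran f = insert (Suc a) (ran g)"
    unfolding fg using gnone by (rule ran_map_upd)
  then have "ran g = ran f \<or> ran g = ran f - {Suc a}"
    by (cases "Suc a \<in> ran g") (simp_all add: insert_absorb)
  moreover have "{1..Suc a} - {Suc a} = {1..a}" by auto
  ultimately have "ran g = {1..Suc a} \<or> ran g = {1..a}" using f(2) by simp
  then have "g \<in> order_surjections b (Suc a) \<union> order_surjections b a"
    using gd gop by (auto simp: order_surjections_def)
  then show "f \<in> (\<lambda>f. f(Suc b \<mapsto> Suc a)) ` (order_surjections b (Suc a) \<union> order_surjections b a)"
    using fg by blast
next
  fix f assume "f \<in> (\<lambda>f. f(Suc b \<mapsto> Suc a)) ` (order_surjections b (Suc a) \<union> order_surjections b a)"
  then obtain g where fg: "f = g(Suc b \<mapsto> Suc a)" and g: "dom g = {1..b}"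
    "ran g = {1..Suc a} \<or> ran g = {1..a}" "order_preserving g"
    by (auto simp: order_surjections_def)
  have "dom f = {1..Suc b}" using g by (auto simp: fg)
  moreover have "ran f = {1..Suc a}"
    unfolding fg using g domIff[of "Suc b" g] by (subst ran_map_upd) auto
  moreover have "order_preserving f"
    unfolding order_preserving_def
  proof (intro ballI impI)
    fix x y assume xy: "x \<in> dom f" "y \<in> dom f" "x \<le> y"
    have "the (g x) \<le> Suc a" if "x \<in> dom g"
    proof -
      have "the (g x) \<in> ran g" using that by (auto simp: ran_def)
      then show ?thesis using g(2) by auto
    qed
    then show "the (f x) \<le> the (f y)"
      using xy g(1,3) by (auto simp: fg order_preserving_def)
  qed
  ultimately show "f \<in> order_surjections (Suc b) (Suc a)" by (simp add: order_surjections_def)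
qed

lemma card_order_surjections_Suc_Suc:
  "card (order_surjections (Suc b) (Suc a)) = card (order_surjections b (Suc a)) + card (order_surjections b a)"
proof -
  have "inj_on (\<lambda>f. f(Suc b \<mapsto> Suc a)) (order_surjections b (Suc a) \<union> order_surjections b a)"
  proof (rule inj_onI, rule ext)
    fix f g x
    assume "f \<in> order_surjections b (Suc a) \<union> order_surjections b a"
      "g \<in> order_surjections b (Suc a) \<union> order_surjections b a"
      and eq: "f(Suc b \<mapsto> Suc a) = g(Suc b \<mapsto> Suc a)"
    then have "dom f = {1..b}" "dom g = {1..b}" by (auto simp: order_surjections_def)
    then have "f (Suc b) = None" "g (Suc b) = None"
      using domIff[of "Suc b" f] domIff[of "Suc b" g] by simp_all
    then show "f x = g x" using fun_cong[OF eq, of x] by (cases "x = Suc b") auto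
  qed
  moreover have "order_surjections b (Suc a) \<inter> order_surjections b a = {}"
    by (auto simp: order_surjections_def)
  ultimately show ?thesis
    by (simp add: order_surjections_Suc_Suc card_image card_Un_disjoint finite_order_surjections)
qed

text \<open>Such a map is a composition of \<open>Suc b\<close> into \<open>Suc a\<close> positive
  parts, the sizes of its fibres: \<open>a\<close> of the \<open>b\<close> gaps between neighbouring
  points are cuts. Hence both arguments of the binomial coefficient are one below the cardinalities,
  which are themselves one below the matrix indices.\<close>

lemma card_order_surjections:
  "card (order_surjections (Suc b) (Suc a)) = b choose a"
proof (induction b arbitrary: a)
  case 0
  show ?case
    by (cases a) (simp_all add: card_order_surjections_Suc_Suc card_order_surjections_0_0 order_surjections_0_Suc)
next
  case (Suc b)
  show ?case
  proof (cases a)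
    \<comment> \<open>With a single value, only the summand that keeps the range survives; a
      nonempty set has no map onto the empty set.\<close>
    case 0
    then show ?thesis
      using Suc[of 0] by (simp add: card_order_surjections_Suc_Suc[of "Suc b"] order_surjections_Suc_0)
  next
    case (Suc a')
    then show ?thesis
      using Suc.IH[of a] Suc.IH[of a'] by (simp add: card_order_surjections_Suc_Suc[of "Suc b"])
  qed
qed

section \<open>The category algebra of \<open>EO n\<close>\<close>

context finite_category
begin

lemma category_algebra_basis_mult:
  assumes "u \<in> Mor C"
  shows "(basis_element u \<otimes>\<^bsub>category_algebra C\<^esub> f) m =
    (\<Sum>q\<in>Mor C. if src C u = tgt C q \<and> cmp C u q = m then f q else 0)"
proof -
  have "(basis_element u \<otimes>\<^bsub>category_algebra C\<^esub> f) m = (\<Sum>p\<in>Mor C. if p = u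
      then (\<Sum>q\<in>Mor C. if src C p = tgt C q \<and> cmp C p q = m then f q else 0) else 0)"
    unfolding category_algebra_mult_left by (intro sum.cong refl) (simp add: basis_element_def)
  then show ?thesis using assms finite_Mor by simp
qed

lemma category_algebra_mult_basis:
  assumes "w \<in> Mor C"
  shows "(f \<otimes>\<^bsub>category_algebra C\<^esub> basis_element w) m =
    (\<Sum>p\<in>Mor C. if src C p = tgt C w \<and> cmp C p w = m then f p else 0)"
proof -
  have "(f \<otimes>\<^bsub>category_algebra C\<^esub> basis_element w) m = (\<Sum>q\<in>Mor C. if q = w
      then (\<Sum>p\<in>Mor C. if src C p = tgt C q \<and> cmp C p q = m then f p else 0) else 0)"
    unfolding category_algebra_mult_right by (intro sum.cong refl) (simp add: basis_element_def)
  then show ?thesis using assms finite_Mor by simp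
qed

text \<open>Used with two kinds of basis elements: identities cut out the span of a hom-set, and
  order isomorphisms carry a morphism of degree 0 to the identity of an interval.\<close>

lemma category_algebra_basis_mult_basis:
  assumes "u \<in> Mor C" "w \<in> Mor C"
  shows "(basis_element u \<otimes>\<^bsub>category_algebra C\<^esub> f \<otimes>\<^bsub>category_algebra C\<^esub> basis_element w) m =
    (\<Sum>q\<in>Mor C. if src C u = tgt C q \<and> src C q = tgt C w \<and> cmp C (cmp C u q) w = m then f q else 0)"
proof -
  have "(basis_element u \<otimes>\<^bsub>category_algebra C\<^esub> f \<otimes>\<^bsub>category_algebra C\<^esub> basis_element w) m =
    (\<Sum>p\<in>Mor C. (basis_element u \<otimes>\<^bsub>category_algebra C\<^esub> f) p *
      (if src C p = tgt C w \<and> cmp C p w = m then 1 else 0))"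
    unfolding category_algebra_mult_basis[OF assms(2)] by (intro sum.cong refl) simp
  also have "\<dots> = (\<Sum>p\<in>Mor C. if p = u then (\<Sum>q\<in>Mor C.
      if src C p = tgt C q \<and> src C q = tgt C w \<and> cmp C (cmp C p q) w = m then f q else 0) else 0)"
    unfolding sum_category_algebra_mult
  proof (rule sum.cong[OF refl])
    fix p assume p: "p \<in> Mor C"
    show "(\<Sum>q\<in>Mor C. if src C p = tgt C q then basis_element u p * f q *
        (if src C (cmp C p q) = tgt C w \<and> cmp C (cmp C p q) w = m then 1 else 0) else 0) =
      (if p = u then \<Sum>q\<in>Mor C.
        if src C p = tgt C q \<and> src C q = tgt C w \<and> cmp C (cmp C p q) w = m then f q else 0 else 0)"
    proof (cases "p = u")
      case True
      then show ?thesis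
        using p by simp (rule sum.cong[OF refl], simp add: src_cmp basis_element_def)
    qed (simp add: basis_element_def)
  qed
  finally show ?thesis using assms finite_Mor by simp
qed

lemma basis_element_carrier: "m \<in> Mor C \<Longrightarrow> basis_element m \<in> carrier (category_algebra C)"
  by (auto simp: category_algebra_simps basis_element_def)

text \<open>A product is written in the order of composition, so the left idempotent fixes the
  target and the right one the source. This decides which half of the Cartan matrix
  vanishes.\<close>

lemma category_algebra_corner:
  assumes "S \<in> Ob C" "T \<in> Ob C" "f \<in> carrier (category_algebra C)"
  shows "basis_element (idt C T) \<otimes>\<^bsub>category_algebra C\<^esub> f \<otimes>\<^bsub>category_algebra C\<^esub> basis_element (idt C S) =
    (\<lambda>m. if tgt C m = T \<and> src C m = S then f m else 0)"
proof
  fix m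
  have "(basis_element (idt C T) \<otimes>\<^bsub>category_algebra C\<^esub> f \<otimes>\<^bsub>category_algebra C\<^esub> basis_element (idt C S)) m =
    (\<Sum>q\<in>Mor C. if q = m then (if tgt C m = T \<and> src C m = S then f m else 0) else 0)"
    unfolding category_algebra_basis_mult_basis[OF idt_Mor[OF assms(2)] idt_Mor[OF assms(1)]]
  proof (rule sum.cong[OF refl])
    fix q assume q: "q \<in> Mor C"
    have "src C (idt C T) = tgt C q \<and> src C q = tgt C (idt C S) \<and> cmp C (cmp C (idt C T) q) (idt C S) = m
      \<longleftrightarrow> q = m \<and> tgt C m = T \<and> src C m = S"
      using cmp_idt_left[OF q] cmp_idt_right[OF q] assms(1,2) by (metis src_idt tgt_idt)
    then show "(if src C (idt C T) = tgt C q \<and> src C q = tgt C (idt C S) \<and>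
        cmp C (cmp C (idt C T) q) (idt C S) = m then f q else 0) =
      (if q = m then if tgt C m = T \<and> src C m = S then f m else 0 else 0)"
      by auto
  qed
  also have "\<dots> = (if tgt C m = T \<and> src C m = S then f m else 0)"
    using finite_Mor assms(3) by (auto simp: category_algebra_simps)
  finally show "(basis_element (idt C T) \<otimes>\<^bsub>category_algebra C\<^esub> f \<otimes>\<^bsub>category_algebra C\<^esub> basis_element (idt C S)) m =
    (if tgt C m = T \<and> src C m = S then f m else 0)" .
qed

lemma basis_idt_mult_basis_idt:
  assumes "S \<in> Ob C"
  shows "basis_element (idt C S) \<otimes>\<^bsub>category_algebra C\<^esub> basis_element (idt C S) = basis_element (idt C S)"
proof
  fix m
  have "(basis_element (idt C S) \<otimes>\<^bsub>category_algebra C\<^esub> basis_element (idt C S)) m =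
    (\<Sum>q\<in>Mor C. if q = idt C S then basis_element (idt C S) m else 0)"
    unfolding category_algebra_basis_mult[OF idt_Mor[OF assms]]
    using assms cmp_idt_left[OF idt_Mor[OF assms]]
    by (intro sum.cong refl) (auto simp: src_idt tgt_idt basis_element_def)
  then show "(basis_element (idt C S) \<otimes>\<^bsub>category_algebra C\<^esub> basis_element (idt C S)) m = basis_element (idt C S) m"
    using finite_Mor idt_Mor[OF assms] by simp
qed

end

section \<open>The category \<open>EO n\<close>, its degree filtration and its idempotents\<close>

lemma EO_simps:
  "Ob (EO n) = Pow {1..n}"
  "m \<in> Mor (EO n) \<longleftrightarrow> dom m \<subseteq> {1..n} \<and> ran m \<subseteq> {1..n} \<and> order_preserving m"
  "src (EO n) = dom" "tgt (EO n) = ran" "idt (EO n) S = Some |` S" "cmp (EO n) = (\<circ>\<^sub>m)"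
  by (simp_all add: EO_def)

lemma finite_Mor_EO: "finite (Mor (EO n))"
proof (rule finite_subset)
  show "Mor (EO n) \<subseteq> (\<Union>A\<in>Pow {1..n}. {m. dom m = A \<and> ran m \<subseteq> {1..n}})"
  proof
    fix m assume m: "m \<in> Mor (EO n)"
    show "m \<in> (\<Union>A\<in>Pow {1..n}. {m. dom m = A \<and> ran m \<subseteq> {1..n}})"
      by (rule UN_I[of "dom m"]) (use m in \<open>simp_all add: EO_simps\<close>)
  qed
  have "finite {m :: nat \<rightharpoonup> nat. dom m = A \<and> ran m \<subseteq> {1..n}}" if "A \<in> Pow {1..n}" for A
    using that finite_subset[of A "{1..n}"] by (intro finite_set_of_finite_maps) simp_all
  then show "finite (\<Union>A\<in>Pow {1..n}. {m :: nat \<rightharpoonup> nat. dom m = A \<and> ran m \<subseteq> {1..n}})"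
    by simp
qed

lemma finite_category_EO: "finite_category (EO n)"
proof
  fix p q r
  show "cmp (EO n) p q \<in> Mor (EO n)"
    if "p \<in> Mor (EO n)" "q \<in> Mor (EO n)" "src (EO n) p = tgt (EO n) q"
    using that order_preserving_comp[of p q] dom_comp[of p q] ran_comp[of p q] by (simp add: EO_simps)
  show "cmp (EO n) p (idt (EO n) (src (EO n) p)) = p"
    by (simp only: EO_simps comp_id)
qed (simp_all add: EO_simps finite_Mor_EO dom_comp ran_comp map_comp_assoc id_comp dom_id ran_id order_preserving_id)

text \<open>The span of the morphisms of degree at least \<open>k\<close>, where the degree is
  \<open>card (dom m) - card (ran m)\<close>. The additive form avoids truncated
  subtraction.\<close>

definition EO_filtration :: "nat \<Rightarrow> nat \<Rightarrow> ((nat \<rightharpoonup> nat) \<Rightarrow> 'k::field) set" where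
  "EO_filtration n k = {f \<in> carrier (category_algebra (EO n)).
    \<forall>m. f m \<noteq> 0 \<longrightarrow> k + card (ran m) \<le> card (dom m)}"

lemma EO_morphism_card:
  assumes "m \<in> Mor (EO n)"
  shows "finite (dom m)" "finite (ran m)" "card (ran m) \<le> card (dom m)" "card (dom m) \<le> n"
proof -
  show "finite (dom m)" "finite (ran m)" using assms finite_subset by (auto simp: EO_simps)
  then show "card (ran m) \<le> card (dom m)" by (simp add: card_ran_le)
  show "card (dom m) \<le> n" using assms card_mono[of "{1..n}" "dom m"] by (auto simp: EO_simps)
qed

text \<open>By rigidity an interval has no other order-preserving map onto itself; this is why the
  corners \<open>e A e\<close> are one-dimensional.\<close>

lemma EO_endomorphism_id:
  assumes "m \<in> Mor (EO n)" "dom m = {1..k}" "ran m = {1..k}"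
  shows "m = Some |` {1..k}"
  using assms by (intro order_preserving_bijection_unique)
    (simp_all add: EO_simps dom_id ran_id order_preserving_id)

text \<open>\<open>w\<close> and \<open>u\<close> are the order isomorphisms from the interval of
  length \<open>card (dom m)\<close> onto \<open>dom m\<close> and from \<open>ran m\<close> back to
  that interval. Sandwiching \<open>f\<close> between them removes every term except the one at
  \<open>m\<close>.\<close>

lemma EO_isomorphism_to_interval:
  fixes f :: "(nat \<rightharpoonup> nat) \<Rightarrow> 'k::field"
  assumes "f \<in> carrier (category_algebra (EO n))" "f m \<noteq> 0" "card (ran m) = card (dom m)"
  obtains u w where "u \<in> Mor (EO n)" "w \<in> Mor (EO n)"
    "basis_element u \<otimes>\<^bsub>category_algebra (EO n)\<^esub> f \<otimes>\<^bsub>category_algebra (EO n)\<^esub> basis_element w =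
      (\<lambda>m'. f m * basis_element (Some |` {1..card (dom m)}) m')"
proof -
  interpret finite_category "EO n" by (rule finite_category_EO)
  have m: "m \<in> Mor (EO n)" using assms(1,2) by (auto simp: category_algebra_simps)
  note mc = EO_morphism_card[OF m]
  define k where "k = card (dom m)"
  obtain u where u: "dom u = ran m" "ran u = {1..k}" "order_preserving u"
    using order_preserving_bijection_exists[of "ran m" "{1..k}"] mc assms(3) by (auto simp: k_def)
  obtain w where w: "dom w = {1..k}" "ran w = dom m" "order_preserving w"
    using order_preserving_bijection_exists[of "{1..k}" "dom m"] mc by (auto simp: k_def)
  have um: "u \<in> Mor (EO n)" "w \<in> Mor (EO n)"
    using u w m mc(4) by (auto simp: EO_simps k_def)
  \<comment> \<open>A morphism fitting between \<open>w\<close> and \<open>u\<close> has the domain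
    and range of \<open>m\<close>, so it is \<open>m\<close> by rigidity. The triple composite maps
    an interval onto itself and is therefore the identity.\<close>
  have comp: "(dom u = ran q \<and> dom q = ran w \<and> (u \<circ>\<^sub>m q) \<circ>\<^sub>m w = m') \<longleftrightarrow> q = m \<and> m' = Some |` {1..k}"
    if q: "q \<in> Mor (EO n)" for q m'
  proof -
    have "q = m" if "dom u = ran q" "dom q = ran w"
      using that u w q m mc assms(3) by (intro order_preserving_bijection_unique) (auto simp: EO_simps)
    moreover have "(u \<circ>\<^sub>m m) \<circ>\<^sub>m w = Some |` {1..k}"
    proof (rule EO_endomorphism_id)
      show "(u \<circ>\<^sub>m m) \<circ>\<^sub>m w \<in> Mor (EO n)"
        using cmp_Mor[of u m] cmp_Mor[of "u \<circ>\<^sub>m m" w] um m u w by (simp add: EO_simps(3-) dom_comp)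
    qed (use u w in \<open>simp_all add: dom_comp ran_comp\<close>)
    ultimately show ?thesis using u w by auto
  qed
  have "(basis_element u \<otimes>\<^bsub>category_algebra (EO n)\<^esub> f \<otimes>\<^bsub>category_algebra (EO n)\<^esub> basis_element w) m' =
      f m * basis_element (Some |` {1..k}) m'" for m'
  proof -
    have "(basis_element u \<otimes>\<^bsub>category_algebra (EO n)\<^esub> f \<otimes>\<^bsub>category_algebra (EO n)\<^esub> basis_element w) m' =
      (\<Sum>q\<in>Mor (EO n). if q = m then f m * basis_element (Some |` {1..k}) m' else 0)"
      unfolding category_algebra_basis_mult_basis[OF um] unfolding EO_simps(3-6)
      by (intro sum.cong refl) (simp add: comp basis_element_def)
    then show ?thesis using finite_Mor m by simp
  qed
  then show thesis using that um unfolding k_def by blast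
qed

lemma primitive_idempotent_system_EO:
  "primitive_idempotent_system (category_algebra (EO n) :: ('k::field, (nat \<rightharpoonup> nat) \<Rightarrow> 'k) module)
    (EO_filtration n) (Suc n) (EO_idempotents n)"
proof -
  let ?A = "category_algebra (EO n) :: ('k, (nat \<rightharpoonup> nat) \<Rightarrow> 'k) module"
  interpret finite_category "EO n" by (rule finite_category_EO)
  interpret A: fin_dim_algebra class_ring ?A by (rule fin_dim_algebra_category_algebra)
  let ?e = "\<lambda>k. basis_element (Some |` {1..k}) :: (nat \<rightharpoonup> nat) \<Rightarrow> 'k"
  have es: "set (EO_idempotents n :: ((nat \<rightharpoonup> nat) \<Rightarrow> 'k) list) = ?e ` {..n}"
    by (simp add: EO_idempotents_def EO_simps atLeast0LessThan lessThan_Suc_atMost del: upt_Suc)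
  have nth: "EO_idempotents n ! i = ?e i" "i \<le> n"
    if "i < length (EO_idempotents n :: ((nat \<rightharpoonup> nat) \<Rightarrow> 'k) list)" for i
    using that by (auto simp: EO_idempotents_def EO_simps simp del: upt_Suc)
  have ob: "{1..k} \<in> Ob (EO n)" if "k \<le> n" for k using that by (auto simp: EO_simps)
  have eA: "?e k \<in> carrier ?A" if "k \<le> n" for k
    using basis_element_carrier[OF idt_Mor[OF ob[OF that]]] by (simp add: EO_simps)
  have ee: "?e k \<otimes>\<^bsub>?A\<^esub> ?e k = ?e k" if "k \<le> n" for k
    using basis_idt_mult_basis_idt[OF ob[OF that]] by (simp add: EO_simps)
  have corner: "?e i \<otimes>\<^bsub>?A\<^esub> f \<otimes>\<^bsub>?A\<^esub> ?e j = (\<lambda>m. if ran m = {1..i} \<and> dom m = {1..j} then f m else 0)"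
    if "i \<le> n" "j \<le> n" "f \<in> carrier ?A" for i j f
    using category_algebra_corner[OF ob[OF that(2)] ob[OF that(1)] that(3)] by (simp add: EO_simps)
  \<comment> \<open>A set of \<open>j\<close> elements cannot be mapped onto a set of more than
    \<open>j\<close> elements.\<close>
  have corner_0: "?e i \<otimes>\<^bsub>?A\<^esub> f \<otimes>\<^bsub>?A\<^esub> ?e j = \<zero>\<^bsub>?A\<^esub>" if "i \<le> n" "j < i" "f \<in> carrier ?A" for i j f
  proof -
    have "f m = 0" if m: "ran m = {1..i}" "dom m = {1..j}" for m
    proof (rule ccontr)
      assume "f m \<noteq> 0"
      then have "m \<in> Mor (EO n)" using \<open>f \<in> carrier ?A\<close> by (auto simp: category_algebra_simps)
      from EO_morphism_card(3)[OF this] show False using m \<open>j < i\<close> by simp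
    qed
    then show ?thesis
      using that by (subst corner) (auto simp: category_algebra_simps fun_eq_iff)
  qed
  show ?thesis
  proof
    show "EO_filtration n 0 = carrier ?A"
      using EO_morphism_card(3) by (auto simp: EO_filtration_def category_algebra_simps)
    show "EO_filtration n k \<subseteq> carrier ?A" for k by (auto simp: EO_filtration_def)
    \<comment> \<open>The degree never exceeds \<open>card (dom m)\<close>, hence never
      \<open>n\<close>.\<close>
    show "EO_filtration n (Suc n) = {\<zero>\<^bsub>?A\<^esub>}"
    proof -
      have "f = (\<lambda>m. 0)" if "f \<in> EO_filtration n (Suc n)" for f :: "(nat \<rightharpoonup> nat) \<Rightarrow> 'k"
      proof (rule ext, rule ccontr)
        fix m assume "f m \<noteq> 0"
        then have "Suc n + card (ran m) \<le> card (dom m)" "m \<in> Mor (EO n)"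
          using that by (auto simp: EO_filtration_def category_algebra_simps)
        then show False using EO_morphism_card(4)[of m n] by simp
      qed
      then show ?thesis by (auto simp: EO_filtration_def category_algebra_simps)
    qed
    show "\<zero>\<^bsub>?A\<^esub> \<in> EO_filtration n k" for k
      by (simp add: EO_filtration_def category_algebra_simps)
    show "f \<oplus>\<^bsub>?A\<^esub> g \<in> EO_filtration n k" if "f \<in> EO_filtration n k" "g \<in> EO_filtration n k" for f g k
      using that by (auto simp: EO_filtration_def category_algebra_simps) (metis add.right_neutral)
    show "f \<otimes>\<^bsub>?A\<^esub> g \<in> EO_filtration n (Suc k)" if fg: "f \<in> EO_filtration n k" "g \<in> EO_filtration n 1" for f g k
      unfolding EO_filtration_def
    proof (intro CollectI conjI allI impI)
      show "f \<otimes>\<^bsub>?A\<^esub> g \<in> carrier ?A" using fg by (auto simp: EO_filtration_def)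
      fix m assume "(f \<otimes>\<^bsub>?A\<^esub> g) m \<noteq> 0"
      then obtain p where "p \<in> Mor (EO n)" and "(\<Sum>q\<in>Mor (EO n).
          if src (EO n) p = tgt (EO n) q \<and> cmp (EO n) p q = m then f p * g q else 0) \<noteq> 0"
        unfolding category_algebra_mult by (rule sum.not_neutral_contains_not_neutral)
      then obtain q where "q \<in> Mor (EO n)" and "dom p = ran q" "p \<circ>\<^sub>m q = m" "f p \<noteq> 0" "g q \<noteq> 0"
        by (elim sum.not_neutral_contains_not_neutral) (auto simp: EO_simps split: if_splits)
      moreover from this have "k + card (ran p) \<le> card (dom p)" "1 + card (ran q) \<le> card (dom q)"
        using fg by (auto simp: EO_filtration_def)
      ultimately show "Suc k + card (ran m) \<le> card (dom m)"
        using dom_comp[of p q] ran_comp[of p q] by simp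
    qed
    fix e :: "(nat \<rightharpoonup> nat) \<Rightarrow> 'k"
    assume "e \<in> set (EO_idempotents n)"
    then obtain k where k: "e = ?e k" "k \<le> n" by (auto simp: es)
    show "ring_idempotent ?A e" using k eA ee by (simp add: ring_idempotent_def)
    have e1: "e (Some |` {1..k}) = 1" by (simp add: k basis_element_def)
    then show "e \<noteq> \<zero>\<^bsub>?A\<^esub>" by (metis category_algebra_simps(2) zero_neq_one)
    show "f = \<zero>\<^bsub>?A\<^esub> \<or> f = e" if f: "ring_idempotent ?A f" "e \<otimes>\<^bsub>?A\<^esub> f \<otimes>\<^bsub>?A\<^esub> e = f" for f
    proof -
      have fA: "f \<in> carrier ?A" and ff: "f \<otimes>\<^bsub>?A\<^esub> f = f" using f by (auto simp: ring_idempotent_def)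
      \<comment> \<open>Only the identity survives in the corner, so \<open>f\<close> is the
        multiple \<open>c e\<close>; idempotency then reads \<open>c = c * c\<close> in a
        field.\<close>
      define c where "c = f (Some |` {1..k})"
      have "f m = c * e m" for m
      proof (cases "ran m = {1..k} \<and> dom m = {1..k} \<and> f m \<noteq> 0")
        case True
        then have "m = Some |` {1..k}"
          using EO_endomorphism_id[of m n k] fA by (auto simp: category_algebra_simps)
        then show ?thesis using e1 by (simp add: c_def)
      next
        case False
        then have "f m = 0" using f(2) corner[OF k(2) k(2) fA] k(1) by (metis (mono_tags))
        then show ?thesis by (auto simp: k(1) basis_element_def c_def)
      qed
      then have fc: "f = c \<odot>\<^bsub>?A\<^esub> e" by (auto simp: category_algebra_simps)
      have eA': "e \<in> carrier ?A" "e \<otimes>\<^bsub>?A\<^esub> e = e" using k eA ee by auto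
      have "f \<otimes>\<^bsub>?A\<^esub> f = c \<odot>\<^bsub>?A\<^esub> (c \<odot>\<^bsub>?A\<^esub> e)"
        unfolding fc using eA' A.smult_assoc_left A.smult_assoc_right A.smult_closed by simp
      from trans[OF ff[symmetric] this]
      have "f (Some |` {1..k}) = (c \<odot>\<^bsub>?A\<^esub> (c \<odot>\<^bsub>?A\<^esub> e)) (Some |` {1..k})" by (rule fun_cong)
      then have "c = c * (c * 1)" by (simp only: category_algebra_simps e1 c_def[symmetric])
      then have "c = 0 \<or> c = 1" by simp
      then show ?thesis unfolding fc by (auto simp: category_algebra_simps)
    qed
  next
    fix i j x y
    assume i: "i < length (EO_idempotents n :: ((nat \<rightharpoonup> nat) \<Rightarrow> 'k) list)"
      and j: "j < length (EO_idempotents n :: ((nat \<rightharpoonup> nat) \<Rightarrow> 'k) list)"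
      and xy: "x \<in> carrier ?A" "y \<in> carrier ?A"
      and eq: "EO_idempotents n ! i \<otimes>\<^bsub>?A\<^esub> x \<otimes>\<^bsub>?A\<^esub> EO_idempotents n ! j \<otimes>\<^bsub>?A\<^esub> y \<otimes>\<^bsub>?A\<^esub> EO_idempotents n ! i
        = EO_idempotents n ! i"
    note ni = nth[OF i] and nj = nth[OF j]
    note cl = eA[OF ni(2)] eA[OF nj(2)] xy
    have eq': "?e i \<otimes>\<^bsub>?A\<^esub> x \<otimes>\<^bsub>?A\<^esub> ?e j \<otimes>\<^bsub>?A\<^esub> y \<otimes>\<^bsub>?A\<^esub> ?e i = ?e i"
      using eq ni nj by simp
    show "i = j"
    proof (rule ccontr)
      assume "i \<noteq> j"
      have "?e i \<otimes>\<^bsub>?A\<^esub> x \<otimes>\<^bsub>?A\<^esub> ?e j \<otimes>\<^bsub>?A\<^esub> y \<otimes>\<^bsub>?A\<^esub> ?e i = \<zero>\<^bsub>?A\<^esub>"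
      \<comment> \<open>One of the blocks \<open>e_i x e_j\<close> and \<open>e_j y e_i\<close>
        would have to enlarge a set, so it is zero, and with it the whole product.\<close>
      proof (cases "j < i")
        case True
        then show ?thesis using corner_0[OF ni(2) True xy(1)] cl by simp
      next
        case False
        then have "i < j" using \<open>i \<noteq> j\<close> by simp
        then have "?e i \<otimes>\<^bsub>?A\<^esub> x \<otimes>\<^bsub>?A\<^esub> (?e j \<otimes>\<^bsub>?A\<^esub> y \<otimes>\<^bsub>?A\<^esub> ?e i) = \<zero>\<^bsub>?A\<^esub>"
          using corner_0[OF nj(2) _ xy(2)] cl by simp
        then show ?thesis using cl by (simp add: A.m_assoc)
      qed
      from trans[OF eq'[symmetric] this] have "?e i (Some |` {1..i}) = \<zero>\<^bsub>?A\<^esub> (Some |` {1..i})"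
        by (rule fun_cong)
      then have "?e i (Some |` {1..i}) = 0" by (simp only: category_algebra_simps)
      then show False by (simp add: basis_element_def)
    qed
  next
    fix f assume f: "f \<in> carrier ?A" "f \<notin> EO_filtration n 1"
    then obtain m where m: "f m \<noteq> 0" "\<not> 1 + card (ran m) \<le> card (dom m)"
      by (auto simp: EO_filtration_def)
    then have mM: "m \<in> Mor (EO n)" using f by (auto simp: category_algebra_simps)
    let ?k = "card (dom m)"
    have "card (ran m) = ?k" using m(2) EO_morphism_card(3)[OF mM] by simp
    then obtain u w where uw: "u \<in> Mor (EO n)" "w \<in> Mor (EO n)"
      "basis_element u \<otimes>\<^bsub>?A\<^esub> f \<otimes>\<^bsub>?A\<^esub> basis_element w = (\<lambda>m'. f m * ?e ?k m')"
      using EO_isomorphism_to_interval[OF f(1) m(1)] by metis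
    have c: "basis_element u \<in> carrier ?A" "basis_element w \<in> carrier ?A"
      using uw basis_element_carrier by auto
    \<comment> \<open>The sandwich yields \<open>e\<close> only up to the coefficient
      \<open>f m\<close>, which is nonzero and is divided out on the left factor.\<close>
    have "(inverse (f m) \<odot>\<^bsub>?A\<^esub> basis_element u) \<otimes>\<^bsub>?A\<^esub> f \<otimes>\<^bsub>?A\<^esub> basis_element w =
      inverse (f m) \<odot>\<^bsub>?A\<^esub> (basis_element u \<otimes>\<^bsub>?A\<^esub> f \<otimes>\<^bsub>?A\<^esub> basis_element w)"
      using c f(1) A.smult_assoc_left by simp
    also have "\<dots> = ?e ?k"
      unfolding uw using m(1) by (simp add: category_algebra_simps mult.assoc[symmetric])
    finally have "(inverse (f m) \<odot>\<^bsub>?A\<^esub> basis_element u) \<otimes>\<^bsub>?A\<^esub> f \<otimes>\<^bsub>?A\<^esub> basis_element w = ?e ?k" .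
    moreover have "?e ?k \<in> set (EO_idempotents n)" using EO_morphism_card(4)[OF mM] by (auto simp: es)
    moreover have "inverse (f m) \<odot>\<^bsub>?A\<^esub> basis_element u \<in> carrier ?A" using c A.smult_closed by simp
    ultimately show "\<exists>e\<in>set (EO_idempotents n). \<exists>x\<in>carrier ?A. \<exists>y\<in>carrier ?A. x \<otimes>\<^bsub>?A\<^esub> f \<otimes>\<^bsub>?A\<^esub> y = e"
      using c by blast
  qed
qed

section \<open>The isomorphism with the monoid algebra of \<open>PO n\<close>\<close>

definition monoid_category :: "('b, 'c) monoid_scheme \<Rightarrow> (unit, 'b) category" where
  "monoid_category G = \<lparr>Ob = {()}, Mor = carrier G, src = (\<lambda>_. ()), tgt = (\<lambda>_. ()),
    idt = (\<lambda>_. \<one>\<^bsub>G\<^esub>), cmp = mult G\<rparr>"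

text \<open>With a single object every pair is composable and the unit is the only identity, so the
  two records are literally equal.\<close>

lemma monoid_algebra_eq_category_algebra:
  "monoid_algebra G = category_algebra (monoid_category G)"
  by (simp add: monoid_algebra_def category_algebra_def monoid_category_def)

lemma finite_category_monoid_category:
  assumes "Group.monoid G" "finite (carrier G)"
  shows "finite_category (monoid_category G)"
proof -
  interpret Group.monoid G by fact
  show ?thesis
    by unfold_locales (simp_all add: monoid_category_def assms(2) m_assoc)
qed

text \<open>The two algebras thus live on the same space of functions; they differ in product and
  unit.\<close>

lemma carrier_PO: "carrier (PO n) = Mor (EO n)"
  by (simp add: PO_def EO_def)

lemma monoid_PO: "Group.monoid (PO n)"
proof (rule monoidI)
  show "x \<otimes>\<^bsub>PO n\<^esub> y \<in> carrier (PO n)" if "x \<in> carrier (PO n)" "y \<in> carrier (PO n)" for x y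
  proof -
    have "dom (x \<circ>\<^sub>m y) \<subseteq> dom y" "ran (x \<circ>\<^sub>m y) \<subseteq> ran x"
      unfolding dom_def ran_def by (auto simp: map_comp_Some_iff)
    then show ?thesis
      using that order_preserving_comp[of x y] by (simp add: PO_def) (meson order_trans)
  qed
  show "\<one>\<^bsub>PO n\<^esub> \<in> carrier (PO n)"
    by (simp add: PO_def dom_id ran_id order_preserving_id)
  show "\<one>\<^bsub>PO n\<^esub> \<otimes>\<^bsub>PO n\<^esub> x = x" if "x \<in> carrier (PO n)" for x
  proof -
    have "(Some |` {1..n} \<circ>\<^sub>m x) a = x a" for a
    proof (cases "x a")
      case (Some b)
      then have "b \<in> {1..n}" using that by (auto simp: PO_def intro: ranI)
      then show ?thesis using Some by (simp add: map_comp_def)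
    qed (simp add: map_comp_def)
    then show ?thesis by (auto simp: PO_def)
  qed
  show "x \<otimes>\<^bsub>PO n\<^esub> \<one>\<^bsub>PO n\<^esub> = x" if "x \<in> carrier (PO n)" for x
  proof -
    have "(x \<circ>\<^sub>m Some |` {1..n}) a = x a" for a
      using that domIff[of a x] by (cases "a \<in> {1..n}") (auto simp: map_comp_def PO_def)
    then show ?thesis by (auto simp: PO_def)
  qed
qed (simp add: PO_def map_comp_assoc)

lemma finite_category_PO: "finite_category (monoid_category (PO n))"
  by (rule finite_category_monoid_category) (simp_all add: monoid_PO carrier_PO finite_Mor_EO)

lemma PO_category_simps:
  "Mor (monoid_category (PO n)) = Mor (EO n)" "Ob (monoid_category (PO n)) = {()}"
  "cmp (monoid_category (PO n)) = (\<circ>\<^sub>m)" "idt (monoid_category (PO n)) x = Some |` {1..n}"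
  by (simp_all add: monoid_category_def PO_def EO_def)

text \<open>\<open>restriction_sum\<close> leads from the monoid algebra to the category algebra,
  whereas the theorem asks for the opposite direction.\<close>

lemma algebra_iso_sym:
  assumes "ring A" "\<Phi> \<in> algebra_iso K A B"
    and "\<And>c x. c \<in> carrier K \<Longrightarrow> x \<in> carrier A \<Longrightarrow> c \<odot>\<^bsub>A\<^esub> x \<in> carrier A"
  shows "inv_into (carrier A) \<Phi> \<in> algebra_iso K B A"
proof -
  have iso: "\<Phi> \<in> ring_iso A B" and sm: "\<And>c x. c \<in> carrier K \<Longrightarrow> x \<in> carrier A \<Longrightarrow> \<Phi> (c \<odot>\<^bsub>A\<^esub> x) = c \<odot>\<^bsub>B\<^esub> \<Phi> x"
    using assms(2) by (auto simp: algebra_iso_def)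
  have bij: "bij_betw \<Phi> (carrier A) (carrier B)" by (rule ring_iso_memE(5)[OF iso])
  have "inv_into (carrier A) \<Phi> (c \<odot>\<^bsub>B\<^esub> y) = c \<odot>\<^bsub>A\<^esub> inv_into (carrier A) \<Phi> y"
    if cy: "c \<in> carrier K" "y \<in> carrier B" for c y
  proof -
    obtain x where x: "x \<in> carrier A" "y = \<Phi> x" using bij cy(2) by (metis bij_betw_imp_surj_on imageE)
    have "inv_into (carrier A) \<Phi> (\<Phi> (c \<odot>\<^bsub>A\<^esub> x)) = c \<odot>\<^bsub>A\<^esub> x"
      using assms(3)[OF cy(1) x(1)] bij by (simp add: bij_betw_inv_into_left)
    moreover have "inv_into (carrier A) \<Phi> y = x" using bij x by (simp add: bij_betw_inv_into_left)
    ultimately show ?thesis using sm cy x by simp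
  qed
  then show ?thesis
    using ring_iso_set_sym[OF assms(1) iso] by (simp add: algebra_iso_def)
qed

text \<open>The map sending \<open>f\<close> to the sum of its restrictions, in coordinates: the
  coefficient at \<open>h\<close> collects the coefficients of all extensions of \<open>h\<close>.
  Inverting it amounts to Moebius inversion for the order of restriction.\<close>

definition restriction_sum :: "nat \<Rightarrow> ((nat \<rightharpoonup> nat) \<Rightarrow> 'k::field) \<Rightarrow> (nat \<rightharpoonup> nat) \<Rightarrow> 'k" where
  "restriction_sum n v h = (if h \<in> Mor (EO n) then \<Sum>f\<in>Mor (EO n). v f * (if h \<subseteq>\<^sub>m f then 1 else 0) else 0)"

text \<open>\<open>h\<close> leaves no choice: \<open>b\<close> must be \<open>q\<close> on
  \<open>dom h\<close>, and \<open>a\<close> must be \<open>p\<close> on the image of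
  \<open>dom h\<close> under \<open>q\<close>. These two restrictions compose to \<open>h\<close>
  exactly when \<open>h\<close> is a restriction of the composite.\<close>

lemma restriction_factor:
  assumes "p \<in> Mor (EO n)" "q \<in> Mor (EO n)" "h \<in> Mor (EO n)"
  shows "dom a = ran b \<and> a \<circ>\<^sub>m b = h \<and> a \<subseteq>\<^sub>m p \<and> b \<subseteq>\<^sub>m q \<longleftrightarrow>
    h \<subseteq>\<^sub>m p \<circ>\<^sub>m q \<and> b = q |` dom h \<and> a = p |` ran (q |` dom h)"
proof
  assume L: "dom a = ran b \<and> a \<circ>\<^sub>m b = h \<and> a \<subseteq>\<^sub>m p \<and> b \<subseteq>\<^sub>m q"
  have restr: "f = g |` dom f" if "f \<subseteq>\<^sub>m g" for f g :: "nat \<rightharpoonup> nat"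
  proof
    fix x show "f x = (g |` dom f) x"
    proof (cases "x \<in> dom f")
      case True
      then have "f x = g x" using that unfolding map_le_def by blast
      then show ?thesis using True by simp
    qed (simp add: domIff)
  qed
  have "dom b = dom h" using L dom_comp[of a b] by simp
  then have b: "b = q |` dom h" using L restr[of b q] by simp
  then have a: "a = p |` ran (q |` dom h)" using L restr[of a p] by simp
  have "h x = (p \<circ>\<^sub>m q) x" if x: "x \<in> dom h" for x
  proof -
    obtain z where "h x = Some z" using x by blast
    then obtain y where y: "b x = Some y" "a y = Some z"
      using L map_comp_Some_iff[of a b x z] by blast
    then have "q x = Some y" "p y = Some z"
      using L unfolding map_le_def by (metis domI)+
    then show ?thesis using \<open>h x = Some z\<close> by (simp add: map_comp_def)
  qed
  then show "h \<subseteq>\<^sub>m p \<circ>\<^sub>m q \<and> b = q |` dom h \<and> a = p |` ran (q |` dom h)"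
    using a b by (simp add: map_le_def)
next
  assume R: "h \<subseteq>\<^sub>m p \<circ>\<^sub>m q \<and> b = q |` dom h \<and> a = p |` ran (q |` dom h)"
  have hx: "\<exists>y z. q x = Some y \<and> p y = Some z \<and> h x = Some z" if x: "x \<in> dom h" for x
  proof -
    obtain z where z: "h x = Some z" using x by blast
    then have "(p \<circ>\<^sub>m q) x = Some z" using R x unfolding map_le_def by metis
    then show ?thesis using z map_comp_Some_iff[of p q x z] by blast
  qed
  have "y \<in> dom p" if y: "y \<in> ran (q |` dom h)" for y
  proof -
    obtain x where x: "(q |` dom h) x = Some y" using y unfolding ran_def by blast
    then have "x \<in> dom h" "q x = Some y" by (auto simp: restrict_map_def split: if_splits)
    then show ?thesis using hx[of x] by auto
  qed
  then have da: "dom a = ran b" using R by auto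
  moreover have "(a \<circ>\<^sub>m b) x = h x" for x
  proof (cases "x \<in> dom h")
    case True
    then obtain y z where yz: "q x = Some y" "p y = Some z" "h x = Some z" using hx by blast
    then have "b x = Some y" using R True by simp
    then have "y \<in> ran b" by (rule ranI)
    then have "a y = Some z" using R yz by simp
    then show ?thesis using \<open>b x = Some y\<close> yz by (simp add: map_comp_def)
  next
    case False
    then have "b x = None" using R by simp
    then show ?thesis using False by (simp add: map_comp_def domIff)
  qed
  moreover have "a \<subseteq>\<^sub>m p" "b \<subseteq>\<^sub>m q" using R by (simp_all add: map_le_def)
  ultimately show "dom a = ran b \<and> a \<circ>\<^sub>m b = h \<and> a \<subseteq>\<^sub>m p \<and> b \<subseteq>\<^sub>m q" by blast
qed

lemma EO_restrict:
  assumes "f \<in> Mor (EO n)" shows "f |` A \<in> Mor (EO n)"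
proof -
  have "f |` A \<subseteq>\<^sub>m f" by (simp add: map_le_def)
  then have "order_preserving (f |` A)"
    using assms order_preserving_map_le[of f "f |` A"] by (simp add: EO_simps)
  moreover have "ran (f |` A) \<subseteq> ran f" unfolding ran_def by (auto simp: restrict_map_def split: if_splits)
  ultimately show ?thesis using assms by (auto simp: EO_simps)
qed

lemma sum_swap3: "(\<Sum>p\<in>A. \<Sum>q\<in>B. \<Sum>a\<in>D. F p q a) = (\<Sum>a\<in>D. \<Sum>p\<in>A. \<Sum>q\<in>B. F p q a)"
  by (rule trans[OF _ sum.swap[where g = "\<lambda>p a. \<Sum>q\<in>B. F p q a"]]) (intro sum.cong refl sum.swap)

lemma restriction_sum_mult:
  fixes v w :: "(nat \<rightharpoonup> nat) \<Rightarrow> 'k::field"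
  shows "restriction_sum n (v \<otimes>\<^bsub>monoid_algebra (PO n)\<^esub> w) =
    restriction_sum n v \<otimes>\<^bsub>category_algebra (EO n)\<^esub> restriction_sum n w"
proof
  fix h
  let ?M = "Mor (EO n)"
  interpret E: finite_category "EO n" by (rule finite_category_EO)
  interpret P: finite_category "monoid_category (PO n)" by (rule finite_category_PO)
  show "restriction_sum n (v \<otimes>\<^bsub>monoid_algebra (PO n)\<^esub> w) h =
    (restriction_sum n v \<otimes>\<^bsub>category_algebra (EO n)\<^esub> restriction_sum n w) h"
  proof (cases "h \<in> ?M")
    case False
    have "(restriction_sum n v \<otimes>\<^bsub>category_algebra (EO n)\<^esub> restriction_sum n w) h = 0"
      unfolding E.category_algebra_mult using False E.cmp_Mor by (intro sum.neutral ballI) auto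
    then show ?thesis using False by (simp add: restriction_sum_def)
  next
    case h: True
    \<comment> \<open>Unique factorization: the double sum has at most one nonzero term. That term
      lies within the range of summation because restrictions of morphisms are morphisms, by
      \<open>EO_restrict\<close>.\<close>
    have count: "(\<Sum>a\<in>?M. \<Sum>b\<in>?M. if dom a = ran b \<and> a \<circ>\<^sub>m b = h \<and> a \<subseteq>\<^sub>m p \<and> b \<subseteq>\<^sub>m q then 1 else 0) =
      (if h \<subseteq>\<^sub>m p \<circ>\<^sub>m q then 1 else 0 :: 'k)" if pq: "p \<in> ?M" "q \<in> ?M" for p q
    proof -
      have "(\<Sum>a\<in>?M. \<Sum>b\<in>?M. if dom a = ran b \<and> a \<circ>\<^sub>m b = h \<and> a \<subseteq>\<^sub>m p \<and> b \<subseteq>\<^sub>m q then 1 else 0 :: 'k) =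
        (\<Sum>a\<in>?M. if a = p |` ran (q |` dom h) then
          (\<Sum>b\<in>?M. if b = q |` dom h then (if h \<subseteq>\<^sub>m p \<circ>\<^sub>m q then 1 else 0) else 0) else 0)"
        unfolding restriction_factor[OF pq h] by (intro sum.cong refl) simp
      then show ?thesis using pq by (simp add: EO_restrict finite_Mor_EO)
    qed
    have "restriction_sum n (v \<otimes>\<^bsub>monoid_algebra (PO n)\<^esub> w) h =
      (\<Sum>p\<in>?M. \<Sum>q\<in>?M. v p * w q * (if h \<subseteq>\<^sub>m p \<circ>\<^sub>m q then 1 else 0))"
      using h P.sum_category_algebra_mult[of v w "\<lambda>f. if h \<subseteq>\<^sub>m f then 1 else 0"]
      by (simp add: restriction_sum_def monoid_algebra_eq_category_algebra PO_category_simps)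
    \<comment> \<open>The indicator is replaced by the number of its factorizations, so that the
      sums over \<open>a\<close> and \<open>b\<close> can be moved outside.\<close>
    also have "\<dots> = (\<Sum>p\<in>?M. \<Sum>q\<in>?M. \<Sum>a\<in>?M. \<Sum>b\<in>?M.
        if dom a = ran b \<and> a \<circ>\<^sub>m b = h \<and> a \<subseteq>\<^sub>m p \<and> b \<subseteq>\<^sub>m q then v p * w q else 0)"
      by (intro sum.cong refl) (simp add: count[symmetric] sum_distrib_left if_distrib cong: if_cong)
    also have "\<dots> = (\<Sum>a\<in>?M. \<Sum>b\<in>?M. \<Sum>p\<in>?M. \<Sum>q\<in>?M.
        if dom a = ran b \<and> a \<circ>\<^sub>m b = h \<and> a \<subseteq>\<^sub>m p \<and> b \<subseteq>\<^sub>m q then v p * w q else 0)"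
      by (rule trans[OF sum_swap3]) (intro sum.cong refl sum_swap3)
    also have "\<dots> = (\<Sum>a\<in>?M. \<Sum>b\<in>?M. if dom a = ran b \<and> a \<circ>\<^sub>m b = h
        then restriction_sum n v a * restriction_sum n w b else 0)"
    proof (intro sum.cong refl)
      fix a b assume ab: "a \<in> ?M" "b \<in> ?M"
      have "restriction_sum n v a * restriction_sum n w b =
        (\<Sum>p\<in>?M. \<Sum>q\<in>?M. if a \<subseteq>\<^sub>m p \<and> b \<subseteq>\<^sub>m q then v p * w q else 0)"
        using ab by (simp add: restriction_sum_def sum_product) (intro sum.cong refl, simp)
      then show "(\<Sum>p\<in>?M. \<Sum>q\<in>?M.
          if dom a = ran b \<and> a \<circ>\<^sub>m b = h \<and> a \<subseteq>\<^sub>m p \<and> b \<subseteq>\<^sub>m q then v p * w q else 0) =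
        (if dom a = ran b \<and> a \<circ>\<^sub>m b = h then restriction_sum n v a * restriction_sum n w b else 0)"
      proof (cases "dom a = ran b \<and> a \<circ>\<^sub>m b = h")
        case False
        then show ?thesis by (subst if_not_P[OF False]) (intro sum.neutral ballI if_not_P, blast)
      qed simp
    qed
    also have "\<dots> = (restriction_sum n v \<otimes>\<^bsub>category_algebra (EO n)\<^esub> restriction_sum n w) h"
      unfolding E.category_algebra_mult by (simp add: EO_simps)
    finally show ?thesis .
  qed
qed

text \<open>The restrictions of the identity on \<open>{1..n}\<close> are the partial identities,
  which are the identities of all objects of \<open>EO n\<close>, each occurring once.\<close>

lemma restriction_sum_one:
  "restriction_sum n \<one>\<^bsub>monoid_algebra (PO n)\<^esub> = (\<one>\<^bsub>category_algebra (EO n)\<^esub> :: (nat \<rightharpoonup> nat) \<Rightarrow> 'k::field)"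
proof
  fix h :: "nat \<rightharpoonup> nat"
  interpret P: finite_category "monoid_category (PO n)" by (rule finite_category_PO)
  have "restriction_sum n \<one>\<^bsub>monoid_algebra (PO n)\<^esub> h =
      (if h \<in> Mor (EO n) then if h \<subseteq>\<^sub>m Some |` {1..n} then 1 else 0 else 0 :: 'k)"
    using P.sum_one_category_algebra[of "\<lambda>f. if h \<subseteq>\<^sub>m f then 1 else 0 :: 'k"]
    by (simp add: restriction_sum_def monoid_algebra_eq_category_algebra PO_category_simps)
  also have "\<dots> = (\<Sum>S\<in>Pow {1..n}. if S = dom h then (if h = Some |` dom h then 1 else 0) else 0)"
  proof -
    have "h \<in> Mor (EO n) \<and> h \<subseteq>\<^sub>m Some |` {1..n} \<longleftrightarrow> dom h \<in> Pow {1..n} \<and> h = Some |` dom h"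
    proof (intro iffI conjI)
      assume h: "h \<in> Mor (EO n) \<and> h \<subseteq>\<^sub>m Some |` {1..n}"
      then show "dom h \<in> Pow {1..n}" by (simp add: EO_simps)
      show "h = Some |` dom h"
      proof
        fix x
        show "h x = (Some |` dom h) x"
        proof (cases "x \<in> dom h")
          case True
          then have "h x = (Some |` {1..n}) x" "x \<in> {1..n}"
            using h by (auto simp: map_le_def EO_simps)
          then show ?thesis using True by simp
        qed (simp add: domIff)
      qed
    next
      assume h: "dom h \<in> Pow {1..n} \<and> h = Some |` dom h"
      show "h \<in> Mor (EO n)" using h order_preserving_id[of "dom h"] ran_id[of "dom h"] by (simp add: EO_simps)
      show "h \<subseteq>\<^sub>m Some |` {1..n}"
        unfolding map_le_def
      proof
        fix x assume x: "x \<in> dom h"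
        have "h x = (Some |` dom h) x" using conjunct2[OF h] by (rule fun_cong)
        moreover have "x \<in> {1..n}" using h x by blast
        ultimately show "h x = (Some |` {1..n}) x" using x by simp
      qed
    qed
    then show ?thesis by auto
  qed
  also have "\<dots> = (\<Sum>S\<in>Pow {1..n}. basis_element (Some |` S) h)"
    by (intro sum.cong refl) (auto simp: basis_element_def dom_id)
  also have "\<dots> = (\<one>\<^bsub>category_algebra (EO n)\<^esub> :: (nat \<rightharpoonup> nat) \<Rightarrow> 'k) h"
    by (simp add: category_algebra_def EO_simps)
  finally show "restriction_sum n \<one>\<^bsub>monoid_algebra (PO n)\<^esub> h = (\<one>\<^bsub>category_algebra (EO n)\<^esub> :: (nat \<rightharpoonup> nat) \<Rightarrow> 'k) h" .
qed

section \<open>Bijectivity of the restriction sum\<close>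

lemma map_le_card_dom:
  assumes "h \<subseteq>\<^sub>m f" "finite (dom f)" "card (dom f) \<le> card (dom h)"
  shows "h = f"
proof -
  have "dom h = dom f"
    using assms map_le_implies_dom_le[OF assms(1)] by (simp add: card_seteq)
  then show ?thesis using assms(1) by (intro map_le_antisym) (auto simp: map_le_def)
qed

lemma restriction_sum_eq:
  assumes "h \<in> Mor (EO n)"
  shows "restriction_sum n v h = v h + (\<Sum>f\<in>Mor (EO n) - {h}. if h \<subseteq>\<^sub>m f then v f else 0)"
proof -
  have "restriction_sum n v h = (\<Sum>f\<in>Mor (EO n). if h \<subseteq>\<^sub>m f then v f else 0)"
    using assms by (simp add: restriction_sum_def if_distrib cong: if_cong)
  then show ?thesis using assms by (simp add: sum.remove[OF finite_Mor_EO, of h])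
qed

text \<open>The unitriangularity: a proper extension has a strictly larger domain, so only the
  diagonal term \<open>v h\<close>, with coefficient 1, remains.\<close>

lemma restriction_sum_top:
  assumes "h \<in> Mor (EO n)" "\<And>f. f \<in> Mor (EO n) \<Longrightarrow> card (dom h) < card (dom f) \<Longrightarrow> v f = 0"
  shows "restriction_sum n v h = v h"
proof -
  have "(\<Sum>f\<in>Mor (EO n) - {h}. if h \<subseteq>\<^sub>m f then v f else 0) = 0"
  proof (rule sum.neutral, rule ballI)
    fix f assume f: "f \<in> Mor (EO n) - {h}"
    then have "finite (dom f)" using EO_morphism_card(1) by blast
    then have "card (dom h) < card (dom f)" if "h \<subseteq>\<^sub>m f"
      using map_le_card_dom[OF that] f by force
    then show "(if h \<subseteq>\<^sub>m f then v f else 0) = 0" using assms(2) f by auto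
  qed
  then show ?thesis using restriction_sum_eq[OF assms(1), of v] by simp
qed

lemma restriction_sum_zero_imp:
  assumes "\<And>m. m \<notin> Mor (EO n) \<Longrightarrow> v m = 0" "restriction_sum n v = (\<lambda>m. 0)"
  shows "v = (\<lambda>m. 0)"
proof -
  \<comment> \<open>Induction from the largest domains downwards; for \<open>k = 0\<close> nothing
    is claimed, and \<open>k = Suc n\<close> covers every morphism.\<close>
  have "\<forall>h\<in>Mor (EO n). n - card (dom h) < k \<longrightarrow> v h = 0" for k
  proof (induction k)
    case (Suc k)
    show ?case
    proof (intro ballI impI)
      fix h assume h: "h \<in> Mor (EO n)" "n - card (dom h) < Suc k"
      have "v f = 0" if "f \<in> Mor (EO n)" "card (dom h) < card (dom f)" for f
        using Suc that h EO_morphism_card(4)[OF that(1)] by auto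
      then show "v h = 0" using restriction_sum_top[OF h(1), of v] assms(2) by simp
    qed
  qed simp
  from this[of "Suc n"] have "v h = 0" if "h \<in> Mor (EO n)" for h using that by auto
  then show ?thesis using assms(1) by blast
qed

lemma restriction_sum_add:
  "restriction_sum n (\<lambda>m. v m + w m) = (\<lambda>m. restriction_sum n v m + restriction_sum n w m)"
  by (auto simp: restriction_sum_def sum.distrib distrib_right)

lemma restriction_sum_smult:
  "restriction_sum n (\<lambda>m. c * v m) = (\<lambda>m. c * restriction_sum n v m)"
  by (auto simp: restriction_sum_def sum_distrib_left mult.assoc)

lemma restriction_sum_surj:
  assumes "\<And>m. m \<notin> Mor (EO n) \<Longrightarrow> w m = 0"
  shows "\<exists>v. (\<forall>m. m \<notin> Mor (EO n) \<longrightarrow> v m = 0) \<and> restriction_sum n v = w"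
proof -
  have "\<exists>v. (\<forall>m. m \<notin> Mor (EO n) \<longrightarrow> v m = 0) \<and> restriction_sum n v = w"
    if "\<And>m. m \<notin> Mor (EO n) \<Longrightarrow> w m = 0" "\<And>m. w m \<noteq> 0 \<Longrightarrow> card (dom m) < k" for w :: "(nat \<rightharpoonup> nat) \<Rightarrow> 'k::field" and k
    using that
  proof (induction k arbitrary: w)
    case 0
    then have "w = (\<lambda>m. 0)" by blast
    then show ?case by (intro exI[of _ "\<lambda>m. 0"]) (simp add: restriction_sum_def fun_eq_iff)
  next
    case (Suc k)
    let ?r = "restriction_sum n w"
    \<comment> \<open>On the largest domains in its support \<open>w\<close> agrees with its own
      image. The error \<open>w'\<close> lives on strictly smaller domains, and the induction
      hypothesis supplies a correction to \<open>w\<close>.\<close>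
    define w' where "w' = (\<lambda>m. w m - ?r m)"
    have "w' m = 0" if "m \<notin> Mor (EO n)" for m
      using Suc.prems(1) that by (simp add: w'_def restriction_sum_def)
    moreover have "card (dom m) < k" if "w' m \<noteq> 0" for m
    proof (rule ccontr)
      assume k: "\<not> card (dom m) < k"
      have m: "m \<in> Mor (EO n)" using that calculation by blast
      have "w f = 0" if "card (dom m) < card (dom f)" for f
        using Suc.prems(2)[of f] that k by auto
      then have "?r m = w m" using restriction_sum_top[OF m] by blast
      then show False using \<open>w' m \<noteq> 0\<close> by (simp add: w'_def)
    qed
    ultimately obtain v where v: "\<forall>m. m \<notin> Mor (EO n) \<longrightarrow> v m = 0" "restriction_sum n v = w'"
      using Suc.IH[of w'] by blast
    have "restriction_sum n (\<lambda>m. w m + v m) = w"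
      unfolding restriction_sum_add v(2) by (simp add: w'_def)
    then show ?case
      using v(1) Suc.prems(1) by (intro exI[of _ "\<lambda>m. w m + v m"]) auto
  qed
  from this[of w "Suc n"] show ?thesis
    using assms EO_morphism_card(4) by (meson le_imp_less_Suc)
qed

lemma restriction_sum_algebra_iso:
  "restriction_sum n \<in> algebra_iso class_ring (monoid_algebra (PO n) :: ('k::field, (nat \<rightharpoonup> nat) \<Rightarrow> 'k) module)
    (category_algebra (EO n))"
proof -
  let ?P = "monoid_algebra (PO n) :: ('k, (nat \<rightharpoonup> nat) \<Rightarrow> 'k) module"
  let ?E = "category_algebra (EO n) :: ('k, (nat \<rightharpoonup> nat) \<Rightarrow> 'k) module"
  have car: "carrier ?P = {f. \<forall>m. m \<notin> Mor (EO n) \<longrightarrow> f m = 0}" "carrier ?E = {f. \<forall>m. m \<notin> Mor (EO n) \<longrightarrow> f m = 0}"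
    by (simp_all add: monoid_algebra_def category_algebra_def carrier_PO)
  have ops: "f \<oplus>\<^bsub>?P\<^esub> g = (\<lambda>m. f m + g m)" "f \<oplus>\<^bsub>?E\<^esub> g = (\<lambda>m. f m + g m)"
    "c \<odot>\<^bsub>?P\<^esub> f = (\<lambda>m. c * f m)" "c \<odot>\<^bsub>?E\<^esub> f = (\<lambda>m. c * f m)" for f g c
    by (simp_all add: monoid_algebra_def category_algebra_def)
  have into: "restriction_sum n v \<in> carrier ?E" for v :: "(nat \<rightharpoonup> nat) \<Rightarrow> 'k"
    by (simp add: car restriction_sum_def)
  have "inj_on (restriction_sum n) (carrier ?P)"
  proof (rule inj_onI)
    fix v w assume vw: "v \<in> carrier ?P" "w \<in> carrier ?P" "restriction_sum n v = restriction_sum n w"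
    \<comment> \<open>The difference is written with the factor -1 so that additivity and
      homogeneity of \<open>restriction_sum\<close> apply directly.\<close>
    have "(\<lambda>m. v m + (-1) * w m) = (\<lambda>m. 0)"
    proof (rule restriction_sum_zero_imp)
      show "v m + (-1) * w m = 0" if "m \<notin> Mor (EO n)" for m using vw that by (simp add: car)
      show "restriction_sum n (\<lambda>m. v m + (-1) * w m) = (\<lambda>m. 0)"
        unfolding restriction_sum_add restriction_sum_smult by (simp add: vw(3))
    qed
    then show "v = w" by (auto simp: fun_eq_iff)
  qed
  moreover have "restriction_sum n ` carrier ?P = carrier ?E"
  proof (intro equalityI subsetI)
    fix w assume "w \<in> carrier ?E"
    then obtain v where "\<forall>m. m \<notin> Mor (EO n) \<longrightarrow> v m = 0" "restriction_sum n v = w"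
      using restriction_sum_surj[of n w] by (auto simp: car)
    then show "w \<in> restriction_sum n ` carrier ?P" by (auto simp: car)
  qed (use into in auto)
  ultimately have "restriction_sum n \<in> ring_iso ?P ?E"
    using into
    by (intro ring_iso_memI)
      (simp_all add: restriction_sum_mult restriction_sum_one ops restriction_sum_add bij_betw_def)
  then show ?thesis by (simp add: algebra_iso_def ops restriction_sum_smult)
qed

section \<open>The Cartan matrix\<close>

text \<open>Rank-nullity with trivial kernel. The image is expressed by a changed carrier, the form
  in which \<open>is_cartan_matrix\<close> presents corners.\<close>

lemma dim_inj_image:
  assumes "vectorspace K V" "vectorspace K W" "vectorspace.fin_dim K V"
    and "\<And>x. x \<in> carrier V \<Longrightarrow> T x \<in> carrier W"
    and "\<And>x y. x \<in> carrier V \<Longrightarrow> y \<in> carrier V \<Longrightarrow> T (x \<oplus>\<^bsub>V\<^esub> y) = T x \<oplus>\<^bsub>W\<^esub> T y"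
    and "\<And>c x. c \<in> carrier K \<Longrightarrow> x \<in> carrier V \<Longrightarrow> T (c \<odot>\<^bsub>V\<^esub> x) = c \<odot>\<^bsub>W\<^esub> T x"
    and inj: "inj_on T (carrier V)"
  shows "vectorspace.dim K (W\<lparr>carrier := T ` carrier V\<rparr>) = vectorspace.dim K V"
proof -
  interpret V: vectorspace K V by fact
  interpret W: vectorspace K W by fact
  have "T \<in> LinearCombinations.module_hom K V W"
    using assms(4-6) unfolding LinearCombinations.module_hom_def by blast
  then interpret T: linear_map K V W T by unfold_locales
  show ?thesis
    using T.rank_nullity[OF assms(3)] T.inj_imp_dim_ker0[OF inj] by (simp add: T.im_def)
qed

text \<open>Identifies the corner with all functions supported on a hom-set, so that its dimension
  becomes a cardinality. The indices are exchanged because \<open>order_surjections\<close> takes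
  the source first.\<close>

lemma EO_corner:
  fixes A :: "('k::field, (nat \<rightharpoonup> nat) \<Rightarrow> 'k) module"
  assumes "i \<le> n" "j \<le> n" and A: "A = category_algebra (EO n)"
  shows "{basis_element (idt (EO n) {1..i}) \<otimes>\<^bsub>A\<^esub> a \<otimes>\<^bsub>A\<^esub> basis_element (idt (EO n) {1..j}) | a. a \<in> carrier A} =
    {f. \<forall>m. m \<notin> order_surjections j i \<longrightarrow> f m = 0}"
proof -
  interpret finite_category "EO n" by (rule finite_category_EO)
  have corner: "basis_element (idt (EO n) {1..i}) \<otimes>\<^bsub>A\<^esub> f \<otimes>\<^bsub>A\<^esub> basis_element (idt (EO n) {1..j}) =
      (\<lambda>m. if ran m = {1..i} \<and> dom m = {1..j} then f m else 0)" if "f \<in> carrier A" for f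
    using category_algebra_corner[of "{1..j}" "{1..i}" f] that assms by (simp add: EO_simps)
  show ?thesis
  proof (intro equalityI subsetI)
    fix f assume "f \<in> {basis_element (idt (EO n) {1..i}) \<otimes>\<^bsub>A\<^esub> a \<otimes>\<^bsub>A\<^esub> basis_element (idt (EO n) {1..j}) | a. a \<in> carrier A}"
    then obtain a where a: "a \<in> carrier A" "f = (\<lambda>m. if ran m = {1..i} \<and> dom m = {1..j} then a m else 0)"
      using corner by blast
    have "f m = 0" if "m \<notin> order_surjections j i" for m
      using that a by (auto simp: A category_algebra_simps order_surjections_def EO_simps(2))
    then show "f \<in> {f. \<forall>m. m \<notin> order_surjections j i \<longrightarrow> f m = 0}" by blast
  next
    fix f :: "(nat \<rightharpoonup> nat) \<Rightarrow> 'k"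
    assume f: "f \<in> {f. \<forall>m. m \<notin> order_surjections j i \<longrightarrow> f m = 0}"
    have "order_surjections j i \<subseteq> Mor (EO n)"
      using assms(1,2) by (auto simp: order_surjections_def EO_simps)
    then have fA: "f \<in> carrier A" using f by (auto simp: A category_algebra_simps)
    have "f = (\<lambda>m. if ran m = {1..i} \<and> dom m = {1..j} then f m else 0)"
      using f by (auto simp: order_surjections_def)
    then have "f = basis_element (idt (EO n) {1..i}) \<otimes>\<^bsub>A\<^esub> f \<otimes>\<^bsub>A\<^esub> basis_element (idt (EO n) {1..j})"
      using corner[OF fA] by simp
    then show "f \<in> {basis_element (idt (EO n) {1..i}) \<otimes>\<^bsub>A\<^esub> a \<otimes>\<^bsub>A\<^esub> basis_element (idt (EO n) {1..j}) | a. a \<in> carrier A}"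
      using fA by blast
  qed
qed

text \<open>Serves both halves of the theorem: the identity gives the category algebra, and any
  isomorphism onto the monoid algebra gives the latter with the same matrix.\<close>

lemma is_cartan_matrix_EO_iso:
  fixes n :: nat and A B :: "('k::field, (nat \<rightharpoonup> nat) \<Rightarrow> 'k) module"
  defines "A \<equiv> category_algebra (EO n)"
  assumes B: "fin_dim_algebra class_ring B" and \<Phi>: "\<Phi> \<in> algebra_iso class_ring A B"
  shows "is_cartan_matrix TYPE('m) class_ring B (map \<Phi> (EO_idempotents n))
    (mat (n + 1) (n + 1) (\<lambda>(i, j). card (order_surjections j i)))"
proof -
  interpret finite_category "EO n" by (rule finite_category_EO)
  interpret A: fin_dim_algebra class_ring A unfolding A_def by (rule fin_dim_algebra_category_algebra)
  interpret B: fin_dim_algebra class_ring B by fact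
  have iso: "\<Phi> \<in> ring_iso A B" and sm: "\<And>c x. x \<in> carrier A \<Longrightarrow> \<Phi> (c \<odot>\<^bsub>A\<^esub> x) = c \<odot>\<^bsub>B\<^esub> \<Phi> x"
    using \<Phi> by (auto simp: algebra_iso_def)
  note isoE = ring_iso_memE[OF iso]
  let ?es = "EO_idempotents n :: ((nat \<rightharpoonup> nat) \<Rightarrow> 'k) list"
  have len: "length ?es = n + 1" by (simp add: EO_idempotents_def)
  have nth: "?es ! i = basis_element (idt (EO n) {1..i})" if "i < n + 1" for i
    using that by (simp add: EO_idempotents_def del: upt_Suc)
  have "primitive_idempotent_system B (\<lambda>k. \<Phi> ` EO_filtration n k) (Suc n) (map \<Phi> ?es)"
    using primitive_idempotent_system_iso[OF primitive_idempotent_system_EO B.ring_axioms] iso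
    unfolding A_def by blast
  then have "represent_indecomposable_projectives TYPE('m) B (map \<Phi> ?es)"
    by (rule primitive_idempotent_system.represent_indecomposable_projectives)
  moreover have "vectorspace.dim class_ring
      (B\<lparr>carrier := {map \<Phi> ?es ! i \<otimes>\<^bsub>B\<^esub> b \<otimes>\<^bsub>B\<^esub> map \<Phi> ?es ! j | b. b \<in> carrier B}\<rparr>) = card (order_surjections j i)"
    if ij: "i < n + 1" "j < n + 1" for i j
  proof -
    let ?X = "{?es ! i \<otimes>\<^bsub>A\<^esub> a \<otimes>\<^bsub>A\<^esub> ?es ! j | a. a \<in> carrier A}"
    let ?V = "A\<lparr>carrier := ?X\<rparr>"
    have e: "?es ! i \<in> carrier A" "?es ! j \<in> carrier A"
      using ij by (auto simp: nth A_def EO_simps(1) intro!: basis_element_carrier idt_Mor)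
    have X: "?X = {f. \<forall>m. m \<notin> order_surjections j i \<longrightarrow> f m = 0}"
      using EO_corner[of i n j A] ij by (simp add: nth A_def)
    have XA: "?X \<subseteq> carrier A" using e by auto
    have fn: "carrier ?V = {f. \<forall>m. m \<notin> order_surjections j i \<longrightarrow> f m = 0}" "finite (order_surjections j i)"
      "\<zero>\<^bsub>?V\<^esub> = (\<lambda>m. 0)" "f \<oplus>\<^bsub>?V\<^esub> g = (\<lambda>m. f m + g m)" "c \<odot>\<^bsub>?V\<^esub> f = (\<lambda>m. c * f m)" for f g c
      using X by (simp_all add: finite_order_surjections A_def category_algebra_simps)
    \<comment> \<open>\<open>\<Phi>\<close> is multiplicative and onto, so it carries the corner of
      \<open>A\<close> onto the corner of \<open>B\<close> at the transported idempotents.\<close>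
    have "{map \<Phi> ?es ! i \<otimes>\<^bsub>B\<^esub> b \<otimes>\<^bsub>B\<^esub> map \<Phi> ?es ! j | b. b \<in> carrier B} = \<Phi> ` ?X"
    proof -
      have "\<Phi> (?es ! i \<otimes>\<^bsub>A\<^esub> a \<otimes>\<^bsub>A\<^esub> ?es ! j) = \<Phi> (?es ! i) \<otimes>\<^bsub>B\<^esub> \<Phi> a \<otimes>\<^bsub>B\<^esub> \<Phi> (?es ! j)"
        if "a \<in> carrier A" for a
        using isoE(2) e that by simp
      then have "\<Phi> ` ?X = {\<Phi> (?es ! i) \<otimes>\<^bsub>B\<^esub> \<Phi> a \<otimes>\<^bsub>B\<^esub> \<Phi> (?es ! j) | a. a \<in> carrier A}"
        by (auto simp: image_iff) metis
      also have "\<dots> = {\<Phi> (?es ! i) \<otimes>\<^bsub>B\<^esub> b \<otimes>\<^bsub>B\<^esub> \<Phi> (?es ! j) | b. b \<in> \<Phi> ` carrier A}" by blast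
      finally show ?thesis
        using ij isoE(5) by (simp add: len bij_betw_def)
    qed
    moreover have "vectorspace.dim class_ring (B\<lparr>carrier := \<Phi> ` carrier ?V\<rparr>) = vectorspace.dim class_ring ?V"
    proof (rule dim_inj_image)
      show "vectorspace class_ring ?V" by (rule vectorspace_fun[OF fn])
      show "vectorspace.fin_dim class_ring ?V" by (rule fin_dim_fun[OF fn])
      show "vectorspace class_ring B" ..
      show "inj_on \<Phi> (carrier ?V)"
        using isoE(5) XA by (auto simp: bij_betw_def intro: inj_on_subset)
      have VA: "x \<in> carrier A" if "x \<in> carrier ?V" for x using that XA by auto
      show "\<Phi> x \<in> carrier B" "\<Phi> (c \<odot>\<^bsub>?V\<^esub> x) = c \<odot>\<^bsub>B\<^esub> \<Phi> x" if "x \<in> carrier ?V" for c x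
        using VA[OF that] isoE(1) sm by simp_all
      show "\<Phi> (x \<oplus>\<^bsub>?V\<^esub> y) = \<Phi> x \<oplus>\<^bsub>B\<^esub> \<Phi> y" if "x \<in> carrier ?V" "y \<in> carrier ?V" for x y
        using isoE(3)[OF VA[OF that(1)] VA[OF that(2)]] by simp
    qed
    moreover have "vectorspace.dim class_ring ?V = card (order_surjections j i)"
      by (rule dim_fun[OF fn])
    ultimately show ?thesis by simp
  qed
  ultimately show ?thesis
    using B unfolding is_cartan_matrix_def by (auto simp: len intro!: eq_matI)
qed

lemma fin_dim_algebra_PO: "fin_dim_algebra class_ring (monoid_algebra (PO n) :: ('k::field, (nat \<rightharpoonup> nat) \<Rightarrow> 'k) module)"
  unfolding monoid_algebra_eq_category_algebra
  by (rule finite_category.fin_dim_algebra_category_algebra[OF finite_category_PO])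

theorem lemma4p7:
  fixes n :: nat
    and kEO kPO :: "('k::field, (nat \<rightharpoonup> nat) \<Rightarrow> 'k) module"
  assumes "n \<ge> 1"
  defines "kEO \<equiv> category_algebra (EO n)"
    and "kPO \<equiv> monoid_algebra (PO n)"
  shows "\<exists>C.
    is_cartan_matrix TYPE('m) class_ring kEO (EO_idempotents n) C \<and>
    (\<exists>\<Phi>. \<Phi> \<in> algebra_iso class_ring kEO kPO) \<and>
    (\<forall>\<Phi>\<in>algebra_iso class_ring kEO kPO.
       is_cartan_matrix TYPE('m) class_ring kPO (map \<Phi> (EO_idempotents n)) C) \<and>
    C \<in> carrier_mat (n + 1) (n + 1) \<and>
    upper_triangular C \<and>
    (\<forall>i\<in>{1..n+1}. C $$ (i - 1, i - 1) = 1) \<and>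
    (\<forall>i j. 1 \<le> i \<and> i \<le> j \<and> j \<le> n + 1 \<longrightarrow>
       C $$ (i - 1, j - 1) = binom (int j - 2) (int i - 2))"
proof (intro exI conjI ballI allI impI)
  let ?C = "mat (n + 1) (n + 1) (\<lambda>(i, j). card (order_surjections j i))"
  interpret E: fin_dim_algebra class_ring kEO
    unfolding kEO_def by (rule finite_category.fin_dim_algebra_category_algebra[OF finite_category_EO])
  interpret P: fin_dim_algebra class_ring kPO
    unfolding kPO_def by (rule fin_dim_algebra_PO)
  have "id \<in> algebra_iso class_ring kEO kEO"
    by (auto simp: algebra_iso_def ring_iso_set_refl)
  then have "is_cartan_matrix TYPE('m) class_ring kEO (map id (EO_idempotents n)) ?C"
    unfolding kEO_def by (rule is_cartan_matrix_EO_iso[OF E.fin_dim_algebra_axioms[unfolded kEO_def]])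
  then show "is_cartan_matrix TYPE('m) class_ring kEO (EO_idempotents n) ?C"
    by simp
  show "is_cartan_matrix TYPE('m) class_ring kPO (map \<Phi> (EO_idempotents n)) ?C"
    if "\<Phi> \<in> algebra_iso class_ring kEO kPO" for \<Phi>
    using that unfolding kEO_def by (rule is_cartan_matrix_EO_iso[OF P.fin_dim_algebra_axioms])
  have "restriction_sum n \<in> algebra_iso class_ring kPO kEO"
    unfolding kPO_def kEO_def by (rule restriction_sum_algebra_iso)
  then show "inv_into (carrier kPO) (restriction_sum n) \<in> algebra_iso class_ring kEO kPO"
    by (rule algebra_iso_sym[OF P.ring_axioms]) (rule P.smult_closed)
  show "?C \<in> carrier_mat (n + 1) (n + 1)" by simp
  show "upper_triangular ?C"
  proof
    fix i j assume "j < i" "i < dim_row ?C"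
    \<comment> \<open>A surjection cannot have more values than arguments.\<close>
    moreover have "order_surjections j i = {}" if "j < i"
    proof -
      have "card (ran f) \<le> card (dom f)" if "f \<in> order_surjections j i" for f
        using that by (intro card_ran_le) (simp add: order_surjections_def)
      then show ?thesis using \<open>j < i\<close> by (fastforce simp: order_surjections_def)
    qed
    ultimately show "?C $$ (i, j) = 0" by simp
  qed
  have entry: "?C $$ (i - 1, j - 1) = binom (int j - 2) (int i - 2)"
    if ij: "1 \<le> i" "i \<le> j" "j \<le> n + 1" for i j
  proof -
    have C: "?C $$ (i - 1, j - 1) = card (order_surjections (j - 1) (i - 1))" using ij by simp
    \<comment> \<open>The index \<open>i = 1\<close> stands for the empty set and falls under the
      convention for lower index -1. For \<open>i \<ge> 2\<close> also \<open>j \<ge> 2\<close>, and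
      the entry is an ordinary binomial coefficient.\<close>
    consider "i = 1" "j = 1" | b where "i = 1" "j = Suc (Suc b)"
      | a b where "i = Suc (Suc a)" "j = Suc (Suc b)"
    proof -
      have "i = 1 \<or> i = Suc (Suc (i - 2))" "j = 1 \<or> j = Suc (Suc (j - 2))" using ij by linarith+
      then show thesis using that ij by (metis One_nat_def Suc_le_mono le_zero_eq nat.distinct(1))
    qed
    then show ?thesis
      unfolding C
      by cases (simp_all add: binom_def card_order_surjections_0_0 order_surjections_Suc_0 card_order_surjections)
  qed
  then show "?C $$ (i - 1, j - 1) = binom (int j - 2) (int i - 2)"
    if "1 \<le> i \<and> i \<le> j \<and> j \<le> n + 1" for i j
    using that by blast
  show "?C $$ (i - 1, i - 1) = 1" if "i \<in> {1..n + 1}" for i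
  proof -
    have i: "1 \<le> i" "i \<le> n + 1" using that by auto
    show ?thesis unfolding entry[OF i(1) order_refl i(2)] by (simp add: binom_def)
  qed
qed

end
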